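(* Let $f$ be a sufficiently smooth real-valued function and let $u$ be the exact solution of $u'=f(t,u)$ near a fixed time $t$. For real coefficients $a_{ij}$ ($1\le j<i\le4$), $b_1,\dots,b_4$, $c_2,c_3,c_4$ and real numbers $\epsilon_2^2,\epsilon_3^2,\epsilon_4^2$ (not depending on $h$), let $\tau(h)$ be the local truncation error at $t$ of the four-stage RBF Runge-Kutta method (defined in the context). Write $u=u(t)$, $u''=u''(t)=f_t+f_uf$, with $f$ and all its partial derivatives evaluated at $(t,u(t))$. (i) Suppose $b_1+b_2+b_3+b_4=1$, $a_{21}=c_2$, $a_{31}+a_{32}=c_3$, $a_{41}+a_{42}+a_{43}=c_4$, $$b_2c_2+b_3c_3+b_4c_4=\tfrac12,\quad b_2c_2^2+b_3c_3^2+b_4c_4^2=\tfrac13,\quad b_2c_2^3+b_3c_3^3+b_4c_4^3=\tfrac14,$$ $$a_{32}b_3c_2+a_{42}b_4c_2+a_{43}b_4c_3=\tfrac16,\quad a_{32}b_3c_2c_3+a_{42}b_4c_2c_4+a_{43}b_4c_3c_4=\tfrac18,$$ $$a_{32}b_3c_2^2+a_{42}b_4c_2^2+a_{43}b_4c_3^2=\tfrac1{12},\quad a_{32}a_{43}b_4c_2=\tfrac1{24},$$ and $$b_2c_2^2\epsilon_2^2+b_3c_3^2\epsilon_3^2+b_4c_4^2\epsilon_4^2=0,\quad b_2c_2^3\epsilon_2^2+b_3c_3^3\epsilon_3^2+b_4c_4^3\epsilon_4^2=0,\quad a_{32}b_3c_2^2\epsilon_2^2+a_{42}b_4c_2^2\epsilon_2^2+a_{43}b_4c_3^2\epsilon_3^2=0.$$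 Then $\tau(h)=O(h^4)$ as $h\to0$ (the method has order at least $4$). (ii) In each of the following two cases, if $\epsilon_2^2$ is a real root $x$ of the quadratic equation $\alpha x^2+\beta x+\gamma=0$ with the given $\alpha,\beta,\gamma$, then $\tau(h)=O(h^5)$ as $h\to0$ (the method is fifth-order accurate): Case I: $a_{21}=c_2=\frac25$, $a_{31}=-\frac3{20}$, $a_{32}=\frac34$, $c_3=\frac35$, $a_{41}=\frac{19}{44}$, $a_{42}=-\frac{15}{44}$, $a_{43}=\frac{10}{11}$, $c_4=1$, $b_1=\frac{11}{72}$, $b_2=\frac{25}{72}$, $b_3=\frac{25}{72}$, $b_4=\frac{11}{72}$, $\epsilon_3^2=-\frac23\epsilon_2^2$, $\epsilon_4^2=\frac2{11}\epsilon_2^2$, and $$\alpha=672\,(f_u+f_{uu}u)u,$$ $$\beta=-\big(132f_{ttu}+264f_{tuu}f-924f_{tu}f_u-540f_tf_{uu}-1464f_uf_{uu}f+132f_{uuu}f^2+660f_u^3\big)u,$$ $$\begin{aligned}\gamma={}&11f_{tttt}+44f_{tttu}f+66f_{ttuu}f^2+44f_{tuuu}f^3-44f_{ttt}f_u-132f_{ttu}f_uf+330f_tf_{tu}f_u-132f_uf_{tuu}f^2\\&+330f_{tu}f_u^2f+135f_t^2f_{uu}+600f_tf_uf_{uu}f+465f_u^2f_{uu}f^2-44f_uf_{uuu}f^3+11f_{uuuu}f^4-330f_u^3u''.\end{aligned}$$ Case II: $a_{21}=c_2=\frac14$, $a_{31}=-\frac6{25}$, $a_{32}=\frac{21}{25}$,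 $c_3=\frac35$, $a_{41}=\frac65$, $a_{42}=-\frac{57}{35}$, $a_{43}=\frac{10}7$, $c_4=1$, $b_1=\frac19$, $b_2=\frac{16}{63}$, $b_3=\frac{125}{252}$, $b_4=\frac5{36}$, $\epsilon_3^2=-\frac16\epsilon_2^2$, $\epsilon_4^2=\frac1{10}\epsilon_2^2$, and $$\alpha=12\,(f_u+f_{uu}u)u,$$ $$\beta=-\big(12f_{ttu}+24f_{tuu}f-84f_{tu}f_u-84f_uf_{uu}f+12f_{uuu}f^2+60f_u^3\big)u,$$ $$\begin{aligned}\gamma={}&f_{tttt}+4f_{tttu}f+6f_{ttuu}f^2+18f_{tt}f_{tu}+36f_{tu}^2f+4f_{tuuu}f^3-4f_{ttt}f_u-12f_{ttu}f_uf+48f_tf_{tu}f_u\\&-12f_uf_{tuu}f^2-18f_{tt}f_u^2+12f_{tu}f_u^2f+18f_{tt}f_{uu}f+54f_{tu}f_{uu}f^2+48f_tf_uf_{uu}f+30f_u^2f_{uu}f^2\\&+18f_{uu}^2f^3-4f_uf_{uuu}f^3+f_{uuuu}f^4-48f_u^3u''.\end{aligned}$$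
   Context: The four-stage RBF Runge-Kutta method with step $h$ and squared shape parameters $\epsilon_2^2,\epsilon_3^2,\epsilon_4^2\in\mathbb R$ (shape parameters are real or purely imaginary, so their squares are real of either sign) maps the value $v$ at time $t$ to $v+h(b_1k_1+b_2k_2+b_3k_3+b_4k_4)$, where $$k_1=f(t,v),\qquad k_2=f\big(t+c_2h,\;v\,e^{-\epsilon_2^2(c_2h)^2}+h\,a_{21}k_1\big),$$ $$k_3=f\big(t+c_3h,\;v\,e^{-\epsilon_3^2(c_3h)^2}+h(a_{31}k_1+a_{32}k_2)\big),$$ $$k_4=f\big(t+c_4h,\;v\,e^{-\epsilon_4^2(c_4h)^2}+h(a_{41}k_1+a_{42}k_2+a_{43}k_3)\big).$$ Its local truncation error at $t$ is the error of a single step started from the exact value, divided by $h$: $$\tau(h)=\frac{u(t+h)-u(t)}{h}-(b_1k_1+b_2k_2+b_3k_3+b_4k_4)\quad\text{with } v=u(t).$$ The method is said to have order $p$ when $\tau(h)=O(h^p)$. Subscripts $t,u$ on $f$ denote partial derivatives. *)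

theory Defs
  imports "HOL-Analysis.Analysis" "HOL-Library.Landau_Symbols"
begin

definition d_t :: "(real \<Rightarrow> real \<Rightarrow> real) \<Rightarrow> real \<Rightarrow> real \<Rightarrow> real" where
  "d_t f = (\<lambda>t y. deriv (\<lambda>s. f s y) t)"

definition d_u :: "(real \<Rightarrow> real \<Rightarrow> real) \<Rightarrow> real \<Rightarrow> real \<Rightarrow> real" where
  "d_u f = (\<lambda>t y. deriv (\<lambda>z. f t z) y)"

text \<open>The subscript notation: \<open>pd 2 1 f\<close> is \<open>f\<^sub>t\<^sub>t\<^sub>u\<close>, \<open>pd 0 0 f\<close> is \<open>f\<close>.\<close>

definition pd :: "nat \<Rightarrow> nat \<Rightarrow> (real \<Rightarrow> real \<Rightarrow> real) \<Rightarrow> real \<Rightarrow> real \<Rightarrow> real" where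
  "pd i j f = (d_u ^^ j) ((d_t ^^ i) f)"

text \<open>Class \<open>C\<^sup>k\<close>: all partial derivatives of order at most \<open>k\<close>, in any order of
  differentiation, exist and are continuous on \<open>D\<close>. To be used with \<open>D\<close> open, because
  \<^term>\<open>d_t\<close> and \<^term>\<open>d_u\<close> are two-sided derivatives.\<close>

primrec Ck_on :: "nat \<Rightarrow> (real \<times> real) set \<Rightarrow> (real \<Rightarrow> real \<Rightarrow> real) \<Rightarrow> bool" where
  "Ck_on 0 D f \<longleftrightarrow> continuous_on D (\<lambda>(t, y). f t y)"
| "Ck_on (Suc k) D f \<longleftrightarrow> continuous_on D (\<lambda>(t, y). f t y) \<and>
     (\<forall>(t, y) \<in> D. (\<lambda>s. f s y) differentiable (at t) \<and> (\<lambda>z. f t z) differentiable (at y)) \<and>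
     Ck_on k D (d_t f) \<and> Ck_on k D (d_u f)"

text \<open>Coefficients are indexed families \<open>a i j\<close>, \<open>b i\<close>, \<open>c i\<close>; \<open>\<epsilon>sq i\<close> is the squared shape
  parameter \<open>\<epsilon>\<^sub>i\<^sup>2\<close>, a real number of either sign. Only the entries \<open>a i j\<close> with
  \<open>1 \<le> j < i \<le> 4\<close>, \<open>b 1, \<dots>, b 4\<close>, and \<open>c i\<close>, \<open>\<epsilon>sq i\<close> with \<open>2 \<le> i \<le> 4\<close> matter.\<close>

text \<open>The increment \<open>b\<^sub>1 k\<^sub>1 + b\<^sub>2 k\<^sub>2 + b\<^sub>3 k\<^sub>3 + b\<^sub>4 k\<^sub>4\<close> for the value \<open>v\<close> at time \<open>t\<close>.\<close>

definition rbf_rk4_increment ::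
  "(real \<Rightarrow> real \<Rightarrow> real) \<Rightarrow> (nat \<Rightarrow> nat \<Rightarrow> real) \<Rightarrow> (nat \<Rightarrow> real) \<Rightarrow> (nat \<Rightarrow> real) \<Rightarrow>
   (nat \<Rightarrow> real) \<Rightarrow> real \<Rightarrow> real \<Rightarrow> real \<Rightarrow> real" where
  "rbf_rk4_increment f a b c \<epsilon>sq t v h =
    (let k1 = f t v;
         k2 = f (t + c 2 * h) (v * exp (- \<epsilon>sq 2 * (c 2 * h)^2) + h * (a 2 1 * k1));
         k3 = f (t + c 3 * h) (v * exp (- \<epsilon>sq 3 * (c 3 * h)^2) + h * (a 3 1 * k1 + a 3 2 * k2));
         k4 = f (t + c 4 * h) (v * exp (- \<epsilon>sq 4 * (c 4 * h)^2)
                + h * (a 4 1 * k1 + a 4 2 * k2 + a 4 3 * k3))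
     in b 1 * k1 + b 2 * k2 + b 3 * k3 + b 4 * k4)"

definition local_truncation_error ::
  "(real \<Rightarrow> real \<Rightarrow> real) \<Rightarrow> (nat \<Rightarrow> nat \<Rightarrow> real) \<Rightarrow> (nat \<Rightarrow> real) \<Rightarrow> (nat \<Rightarrow> real) \<Rightarrow>
   (nat \<Rightarrow> real) \<Rightarrow> (real \<Rightarrow> real) \<Rightarrow> real \<Rightarrow> real \<Rightarrow> real" where
  "local_truncation_error f a b c \<epsilon>sq u t h =
     (u (t + h) - u t) / h - rbf_rk4_increment f a b c \<epsilon>sq t (u t) h"

definition has_order_at ::
  "(real \<Rightarrow> real \<Rightarrow> real) \<Rightarrow> (nat \<Rightarrow> nat \<Rightarrow> real) \<Rightarrow> (nat \<Rightarrow> real) \<Rightarrow> (nat \<Rightarrow> real) \<Rightarrow>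
   (nat \<Rightarrow> real) \<Rightarrow> (real \<Rightarrow> real) \<Rightarrow> real \<Rightarrow> nat \<Rightarrow> bool" where
  "has_order_at f a b c \<epsilon>sq u t p \<longleftrightarrow>
     (\<lambda>h. local_truncation_error f a b c \<epsilon>sq u t h) \<in> O[at 0](\<lambda>h. h ^ p)"

definition order4_conditions ::
  "(nat \<Rightarrow> nat \<Rightarrow> real) \<Rightarrow> (nat \<Rightarrow> real) \<Rightarrow> (nat \<Rightarrow> real) \<Rightarrow> (nat \<Rightarrow> real) \<Rightarrow> bool" where
  "order4_conditions a b c \<epsilon>sq \<longleftrightarrow>
     b 1 + b 2 + b 3 + b 4 = 1 \<and>
     a 2 1 = c 2 \<and>
     a 3 1 + a 3 2 = c 3 \<and>
     a 4 1 + a 4 2 + a 4 3 = c 4 \<and>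
     b 2 * c 2 + b 3 * c 3 + b 4 * c 4 = 1/2 \<and>
     b 2 * c 2 ^ 2 + b 3 * c 3 ^ 2 + b 4 * c 4 ^ 2 = 1/3 \<and>
     b 2 * c 2 ^ 3 + b 3 * c 3 ^ 3 + b 4 * c 4 ^ 3 = 1/4 \<and>
     a 3 2 * b 3 * c 2 + a 4 2 * b 4 * c 2 + a 4 3 * b 4 * c 3 = 1/6 \<and>
     a 3 2 * b 3 * c 2 * c 3 + a 4 2 * b 4 * c 2 * c 4 + a 4 3 * b 4 * c 3 * c 4 = 1/8 \<and>
     a 3 2 * b 3 * c 2 ^ 2 + a 4 2 * b 4 * c 2 ^ 2 + a 4 3 * b 4 * c 3 ^ 2 = 1/12 \<and>
     a 3 2 * a 4 3 * b 4 * c 2 = 1/24 \<and>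
     b 2 * c 2 ^ 2 * \<epsilon>sq 2 + b 3 * c 3 ^ 2 * \<epsilon>sq 3 + b 4 * c 4 ^ 2 * \<epsilon>sq 4 = 0 \<and>
     b 2 * c 2 ^ 3 * \<epsilon>sq 2 + b 3 * c 3 ^ 3 * \<epsilon>sq 3 + b 4 * c 4 ^ 3 * \<epsilon>sq 4 = 0 \<and>
     a 3 2 * b 3 * c 2 ^ 2 * \<epsilon>sq 2 + a 4 2 * b 4 * c 2 ^ 2 * \<epsilon>sq 2
       + a 4 3 * b 4 * c 3 ^ 2 * \<epsilon>sq 3 = 0"

definition case1_coefficients ::
  "(nat \<Rightarrow> nat \<Rightarrow> real) \<Rightarrow> (nat \<Rightarrow> real) \<Rightarrow> (nat \<Rightarrow> real) \<Rightarrow> (nat \<Rightarrow> real) \<Rightarrow> bool" where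
  "case1_coefficients a b c \<epsilon>sq \<longleftrightarrow>
     a 2 1 = 2/5 \<and> c 2 = 2/5 \<and>
     a 3 1 = - 3/20 \<and> a 3 2 = 3/4 \<and> c 3 = 3/5 \<and>
     a 4 1 = 19/44 \<and> a 4 2 = - 15/44 \<and> a 4 3 = 10/11 \<and> c 4 = 1 \<and>
     b 1 = 11/72 \<and> b 2 = 25/72 \<and> b 3 = 25/72 \<and> b 4 = 11/72 \<and>
     \<epsilon>sq 3 = - 2/3 * \<epsilon>sq 2 \<and> \<epsilon>sq 4 = 2/11 * \<epsilon>sq 2"

definition case2_coefficients ::
  "(nat \<Rightarrow> nat \<Rightarrow> real) \<Rightarrow> (nat \<Rightarrow> real) \<Rightarrow> (nat \<Rightarrow> real) \<Rightarrow> (nat \<Rightarrow> real) \<Rightarrow> bool" where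
  "case2_coefficients a b c \<epsilon>sq \<longleftrightarrow>
     a 2 1 = 1/4 \<and> c 2 = 1/4 \<and>
     a 3 1 = - 6/25 \<and> a 3 2 = 21/25 \<and> c 3 = 3/5 \<and>
     a 4 1 = 6/5 \<and> a 4 2 = - 57/35 \<and> a 4 3 = 10/7 \<and> c 4 = 1 \<and>
     b 1 = 1/9 \<and> b 2 = 16/63 \<and> b 3 = 125/252 \<and> b 4 = 5/36 \<and>
     \<epsilon>sq 3 = - 1/6 * \<epsilon>sq 2 \<and> \<epsilon>sq 4 = 1/10 * \<epsilon>sq 2"

text \<open>In the coefficients of the quadratics, \<open>F i j\<close> is the value at \<open>(t, u(t))\<close> of the partial
  derivative of \<open>f\<close> taken \<open>i\<close> times in \<open>t\<close> and \<open>j\<close> times in \<open>u\<close>, so that \<open>F 0 0\<close> is \<open>f\<close> itself;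
  \<open>v\<close> is \<open>u(t)\<close> and \<open>w\<close> is \<open>u''(t)\<close>.\<close>

definition case1_alpha :: "(nat \<Rightarrow> nat \<Rightarrow> real) \<Rightarrow> real \<Rightarrow> real" where
  "case1_alpha F v = 672 * (F 0 1 + F 0 2 * v) * v"

definition case1_beta :: "(nat \<Rightarrow> nat \<Rightarrow> real) \<Rightarrow> real \<Rightarrow> real" where
  "case1_beta F v =
     - (132 * F 2 1 + 264 * F 1 2 * F 0 0 - 924 * F 1 1 * F 0 1 - 540 * F 1 0 * F 0 2
        - 1464 * F 0 1 * F 0 2 * F 0 0 + 132 * F 0 3 * F 0 0 ^ 2 + 660 * F 0 1 ^ 3) * v"

definition case1_gamma :: "(nat \<Rightarrow> nat \<Rightarrow> real) \<Rightarrow> real \<Rightarrow> real" where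
  "case1_gamma F w =
     11 * F 4 0 + 44 * F 3 1 * F 0 0 + 66 * F 2 2 * F 0 0 ^ 2 + 44 * F 1 3 * F 0 0 ^ 3
     - 44 * F 3 0 * F 0 1 - 132 * F 2 1 * F 0 1 * F 0 0 + 330 * F 1 0 * F 1 1 * F 0 1
     - 132 * F 0 1 * F 1 2 * F 0 0 ^ 2
     + 330 * F 1 1 * F 0 1 ^ 2 * F 0 0 + 135 * F 1 0 ^ 2 * F 0 2
     + 600 * F 1 0 * F 0 1 * F 0 2 * F 0 0 + 465 * F 0 1 ^ 2 * F 0 2 * F 0 0 ^ 2
     - 44 * F 0 1 * F 0 3 * F 0 0 ^ 3 + 11 * F 0 4 * F 0 0 ^ 4 - 330 * F 0 1 ^ 3 * w"

definition case2_alpha :: "(nat \<Rightarrow> nat \<Rightarrow> real) \<Rightarrow> real \<Rightarrow> real" where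
  "case2_alpha F v = 12 * (F 0 1 + F 0 2 * v) * v"

definition case2_beta :: "(nat \<Rightarrow> nat \<Rightarrow> real) \<Rightarrow> real \<Rightarrow> real" where
  "case2_beta F v =
     - (12 * F 2 1 + 24 * F 1 2 * F 0 0 - 84 * F 1 1 * F 0 1 - 84 * F 0 1 * F 0 2 * F 0 0
        + 12 * F 0 3 * F 0 0 ^ 2 + 60 * F 0 1 ^ 3) * v"

definition case2_gamma :: "(nat \<Rightarrow> nat \<Rightarrow> real) \<Rightarrow> real \<Rightarrow> real" where
  "case2_gamma F w =
     F 4 0 + 4 * F 3 1 * F 0 0 + 6 * F 2 2 * F 0 0 ^ 2 + 18 * F 2 0 * F 1 1
     + 36 * F 1 1 ^ 2 * F 0 0 + 4 * F 1 3 * F 0 0 ^ 3 - 4 * F 3 0 * F 0 1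
     - 12 * F 2 1 * F 0 1 * F 0 0 + 48 * F 1 0 * F 1 1 * F 0 1
     - 12 * F 0 1 * F 1 2 * F 0 0 ^ 2 - 18 * F 2 0 * F 0 1 ^ 2
     + 12 * F 1 1 * F 0 1 ^ 2 * F 0 0 + 18 * F 2 0 * F 0 2 * F 0 0
     + 54 * F 1 1 * F 0 2 * F 0 0 ^ 2 + 48 * F 1 0 * F 0 1 * F 0 2 * F 0 0
     + 30 * F 0 1 ^ 2 * F 0 2 * F 0 0 ^ 2
     + 18 * F 0 2 ^ 2 * F 0 0 ^ 3 - 4 * F 0 1 * F 0 3 * F 0 0 ^ 3 + F 0 4 * F 0 0 ^ 4
     - 48 * F 0 1 ^ 3 * w"

end

theory Submission
  imports Defs "HOL-Computational_Algebra.Formal_Power_Series"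
begin

text \<open>
  The order of a one-step method is decided by comparing two power series in the step \<open>h\<close>, that of
  \<open>(u(t + h) - u(t)) / h\<close> and that of the increment \<open>\<Sum>i. b\<^sub>i k\<^sub>i\<close>, coefficient by coefficient. Both are
  recorded here as formal power series: \<open>expands g n G\<close> says that the first
  \<open>n\<close> terms of \<open>G\<close> approximate \<open>g\<close> near \<open>0\<close> with an error \<open>O(h\<^sup>n)\<close>.

  Everything rests on one composition rule, \<open>expands_compose\<close>: if \<open>w\<close> expands to \<open>W\<close> without
  constant term, then \<open>f(t + c h, v + w(h))\<close> expands to the series obtained by substituting \<open>c h\<close> and \<open>W\<close>
  into the Taylor polynomial of \<open>f\<close>. It comes from a Taylor bound in two variables. That bound
  expands first in \<open>t\<close> and then in \<open>u\<close>, which produces exactly the derivatives \<open>pd i j\<close>.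

  The exact solution is expanded by integration rather than by repeated differentiation. If \<open>u(t + h) - u(t)\<close> is known up to
  \<open>O(h\<^sup>n)\<close>, then so is its derivative \<open>f(t + h, u(t + h))\<close> by composition, and integrating gains one
  order. This is Picard iteration on formal power series (\<open>exact_solution_expands\<close>). The stages
  \<open>k\<^sub>1, \<dots>, k\<^sub>4\<close> are plain compositions; the factor \<open>exp(- \<epsilon>\<^sub>i\<^sup>2 (c\<^sub>i h)\<^sup>2)\<close> only adds the terms of
  \<open>v (p h\<^sup>2 + p\<^sup>2 h\<^sup>4 / 2)\<close> with \<open>p = - \<epsilon>\<^sub>i\<^sup>2 c\<^sub>i\<^sup>2\<close> to the argument (\<open>expands_stage\<close>).

  The row-sum conditions make the linear part of every stage argument a multiple of the direction
  \<open>(1, f)\<close>. Hence the derivatives of \<open>f\<close> enter mostly through the frozen total derivatives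
  \<open>(\<partial>\<^sub>t + \<phi> \<partial>\<^sub>u)\<^sup>n\<close>, where \<open>\<phi>\<close> is the constant \<open>f(t, u(t))\<close>. In terms of these the coefficients of
  \<open>h\<^sup>0, \<dots>, h\<^sup>3\<close> of the two series agree as soon as the scalar factors do, and the order conditions
  say that they do (\<open>order4_coefficients\<close>). In the two special cases the order conditions hold
  whatever \<open>\<epsilon>\<^sub>2\<^sup>2\<close> is, and the coefficient of \<open>h\<^sup>4\<close> in the error is a constant multiple of
  \<open>\<alpha> x\<^sup>2 + \<beta> x + \<gamma>\<close> at \<open>x = \<epsilon>\<^sub>2\<^sup>2\<close> (\<open>case1_leading_error\<close>, \<open>case2_leading_error\<close>); a root \<open>x\<close> of this
  polynomial gains an order.
\<close>

section \<open>Expansions at zero as truncated power series\<close>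

definition expands :: "(real \<Rightarrow> real) \<Rightarrow> nat \<Rightarrow> real fps \<Rightarrow> bool" where
  "expands g n G \<longleftrightarrow> (\<lambda>h. g h - (\<Sum>k<n. fps_nth G k * h ^ k)) \<in> O[at 0](\<lambda>h. h ^ n)"

lemma power_bigo_power_at_0:
  assumes "n \<le> k"
  shows "(\<lambda>h::real. h ^ k) \<in> O[at 0](\<lambda>h. h ^ n)"
proof (rule bigoI[of _ 1])
  have "\<forall>\<^sub>F h::real in at 0. \<bar>h\<bar> < 1"
    by (auto simp: eventually_at dist_real_def intro!: exI[of _ 1])
  then show "\<forall>\<^sub>F h::real in at 0. norm (h ^ k) \<le> 1 * norm (h ^ n)"
    by eventually_elim (simp add: power_abs power_decreasing assms)
qed

lemma expands_mono:
  assumes "expands g n G" "m \<le> n"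
  shows "expands g m G"
proof -
  have split: "(\<Sum>k<n. fps_nth G k * h ^ k) = (\<Sum>k<m. fps_nth G k * h ^ k) + (\<Sum>k\<in>{m..<n}. fps_nth G k * h ^ k)" for h
    using assms(2) by (metis atLeast0LessThan le0 sum.atLeastLessThan_concat)
  have "(\<lambda>h. (g h - (\<Sum>k<n. fps_nth G k * h ^ k)) + (\<Sum>k\<in>{m..<n}. fps_nth G k * h ^ k)) \<in> O[at 0](\<lambda>h. h ^ m)"
  proof (intro sum_in_bigo(1) big_sum_in_bigo)
    show "(\<lambda>h. g h - (\<Sum>k<n. fps_nth G k * h ^ k)) \<in> O[at 0](\<lambda>h. h ^ m)"
      using landau_o.big_trans[OF assms(1)[unfolded expands_def] power_bigo_power_at_0[OF assms(2)]] .
  qed (simp add: power_bigo_power_at_0)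
  then show ?thesis
    by (simp add: expands_def split)
qed

lemma expands_bigo_1: "expands g n G \<Longrightarrow> g \<in> O[at 0](\<lambda>_. 1)"
  using expands_mono[of g n G 0] by (simp add: expands_def)

lemma expands_bigo_h:
  assumes "expands g n G" "n \<ge> 1" "fps_nth G 0 = 0"
  shows "g \<in> O[at 0](\<lambda>h. h)"
  using expands_mono[OF assms(1,2)] assms(3) by (simp add: expands_def)

lemma expands_add:
  assumes "expands g n G" "expands h n H"
  shows "expands (\<lambda>x. g x + h x) n (G + H)"
  using sum_in_bigo(1)[OF assms[unfolded expands_def]]
  by (simp add: expands_def algebra_simps sum.distrib)

lemma expands_uminus: "expands g n G \<Longrightarrow> expands (\<lambda>x. - g x) n (- G)"
  unfolding expands_def
  by (subst landau_o.big.uminus_in_iff[symmetric]) (simp add: sum_negf)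

lemma expands_diff:
  assumes "expands g n G" "expands h n H"
  shows "expands (\<lambda>x. g x - h x) n (G - H)"
  using expands_add[OF assms(1) expands_uminus[OF assms(2)]] by simp

lemma expands_const: "expands (\<lambda>_. a) n (fps_const a)"
proof -
  have "(\<Sum>k<n. fps_nth (fps_const a) k * h ^ k) = (if n = 0 then 0 else a)" for h :: real
  proof -
    have "(\<Sum>k<n. fps_nth (fps_const a) k * h ^ k) = (\<Sum>k<n. if k = 0 then a else 0)"
      by (intro sum.cong) auto
    then show ?thesis by simp
  qed
  then show ?thesis by (cases "n = 0") (simp_all add: expands_def)
qed

lemma expands_X: "expands (\<lambda>h. h) n fps_X"
proof -
  have "(\<Sum>k<n. fps_nth fps_X k * h ^ k) = (if 1 < n then h else 0)" for h :: real
  proof -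
    have "(\<Sum>k<n. fps_nth fps_X k * h ^ k) = (\<Sum>k<n. if k = 1 then h else 0)"
      by (intro sum.cong) (auto simp: fps_X_def)
    then show ?thesis by simp
  qed
  moreover have "n \<le> 1 \<Longrightarrow> (\<lambda>h::real. h) \<in> O[at 0](\<lambda>h. h ^ n)"
    using power_bigo_power_at_0[of n 1] by simp
  ultimately show ?thesis by (cases "1 < n") (auto simp: expands_def)
qed

text \<open>
  The product of the two truncations contains, beyond the truncation of the product series, only
  terms of degree at least \<open>n\<close>.
\<close>

lemma expands_mult:
  assumes "expands g n G" "expands h n H"
  shows "expands (\<lambda>x. g x * h x) n (G * H)"
proof -
  define p where "p x = (\<Sum>k<n. fps_nth G k * x ^ k)" for x
  define q where "q x = (\<Sum>k<n. fps_nth H k * x ^ k)" for x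
  define r where "r x = (\<Sum>k<n. fps_nth (G * H) k * x ^ k)" for x
  let ?low = "{(i, j). i + j < n}" and ?sq = "{..<n} \<times> {..<n}"
  let ?s = "\<lambda>x (i, j). fps_nth G i * fps_nth H j * x ^ (i + j)"
  have pq: "p x * q x = sum (?s x) ?sq" for x
    unfolding p_def q_def by (simp add: sum_product sum.cartesian_product power_add mult_ac)
  have r: "r x = sum (?s x) ?low" for x
    unfolding r_def
    by (subst sum.triangle_reindex) (auto simp: fps_mult_nth atLeast0AtMost sum_distrib_right intro!: sum.cong)
  have "p x * q x - r x = sum (?s x) (?sq - ?low)" for x
    unfolding pq r by (subst sum_diff) auto
  then have pqr: "(\<lambda>x. p x * q x - r x) \<in> O[at 0](\<lambda>x. x ^ n)"
  proof (simp only:, intro big_sum_in_bigo)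
    fix y assume "y \<in> ?sq - ?low"
    then obtain i j where "y = (i, j)" "n \<le> i + j" by auto
    then show "(\<lambda>x. ?s x y) \<in> O[at 0](\<lambda>x. x ^ n)"
      using power_bigo_power_at_0[of n "i + j"] by simp
  qed
  have gp: "(\<lambda>x. g x - p x) \<in> O[at 0](\<lambda>x. x ^ n)" and hq: "(\<lambda>x. h x - q x) \<in> O[at 0](\<lambda>x. x ^ n)"
    using assms by (simp_all add: expands_def p_def q_def)
  have p1: "p \<in> O[at 0](\<lambda>_. 1)"
    unfolding p_def using power_bigo_power_at_0[of 0] by (auto intro!: big_sum_in_bigo)
  have "(\<lambda>x. (g x - p x) * h x + p x * (h x - q x) + (p x * q x - r x)) \<in> O[at 0](\<lambda>x. x ^ n)"
    using landau_o.big.mult[OF gp expands_bigo_1[OF assms(2)]] landau_o.big.mult[OF p1 hq] pqr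
    by (intro sum_in_bigo(1)) simp_all
  then show ?thesis
    by (simp add: expands_def r_def algebra_simps)
qed

lemma expands_power: "expands g n G \<Longrightarrow> expands (\<lambda>x. g x ^ k) n (G ^ k)"
  by (induction k) (auto intro: expands_mult expands_const[of 1, simplified])

lemma expands_sum:
  "(\<And>i. i \<in> I \<Longrightarrow> expands (g i) n (G i)) \<Longrightarrow> expands (\<lambda>x. \<Sum>i\<in>I. g i x) n (\<Sum>i\<in>I. G i)"
  by (induction I rule: infinite_finite_induct)
     (auto intro: expands_add expands_const[of 0, simplified])

lemma expands_perturb:
  assumes "expands g n G" "(\<lambda>x. h x - g x) \<in> O[at 0](\<lambda>x. x ^ n)"
  shows "expands h n G"
  using sum_in_bigo(1)[OF assms(2) assms(1)[unfolded expands_def]]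
  by (simp add: expands_def)

text \<open>
  The mean value theorem turns a bound \<open>C \<bar>h\<bar>\<^sup>n\<close> on the derivative of the remainder into a bound
  \<open>C \<bar>h\<bar>\<^sup>n\<^sup>+\<^sup>1\<close> on the remainder. Differentiating an expansion would be unsound, but integrating is not.
\<close>

lemma expands_integral:
  assumes deriv: "\<forall>\<^sub>F h in nhds 0. (w has_real_derivative w' h) (at h)"
    and "expands w' n G" and "w 0 = 0"
  shows "expands w (Suc n) (fps_integral0 G)"
proof -
  define e where "e h = w h - (\<Sum>k<Suc n. fps_nth (fps_integral0 G) k * h ^ k)" for h
  define e' where "e' h = w' h - (\<Sum>k<n. fps_nth G k * h ^ k)" for h
  have e_eq: "e h = w h - (\<Sum>k<n. fps_nth G k * h ^ Suc k / real (Suc k))" for h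
    by (simp add: e_def sum.lessThan_Suc_shift field_simps del: sum.lessThan_Suc)
  have e0: "e 0 = 0"
    using assms(3) by (simp add: e_eq)
  have de: "(e has_real_derivative e' h) (at h)" if "(w has_real_derivative w' h) (at h)" for h
    unfolding e_eq[abs_def] e'_def
    by (rule derivative_eq_intros that refl | simp)+ (simp add: mult.commute)
  obtain C where C: "C > 0" "\<forall>\<^sub>F h in at 0. norm (e' h) \<le> C * norm (h ^ n)"
    using assms(2) unfolding expands_def e'_def by (elim landau_o.bigE)
  obtain r1 where r1: "r1 > 0" "\<And>h. dist h 0 < r1 \<Longrightarrow> (w has_real_derivative w' h) (at h)"
    using deriv unfolding eventually_nhds_metric by auto
  obtain r2 where r2: "r2 > 0" "\<And>h. h \<noteq> 0 \<Longrightarrow> dist h 0 < r2 \<Longrightarrow> norm (e' h) \<le> C * norm (h ^ n)"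
    using C(2) unfolding eventually_at by auto
  have "norm (e h) \<le> C * norm (h ^ Suc n)" if h: "h \<noteq> 0" "dist h 0 < min r1 r2" for h
  proof -
    have "\<exists>z. \<bar>z\<bar> < \<bar>h\<bar> \<and> z \<noteq> 0 \<and> e h = h * e' z"
    proof (cases "h > 0")
      case True
      have "\<exists>z>0. z < h \<and> e h - e 0 = (h - 0) * e' z"
        by (rule MVT2[OF True], rule de, rule r1(2)) (use h in auto)
      then obtain z where "0 < z" "z < h" "e h - e 0 = (h - 0) * e' z" by blast
      with e0 have "\<bar>z\<bar> < \<bar>h\<bar> \<and> z \<noteq> 0 \<and> e h = h * e' z" by simp
      then show ?thesis by blast
    next
      case False
      then have neg: "h < 0" using h by simp
      have "\<exists>z>h. z < 0 \<and> e 0 - e h = (0 - h) * e' z"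
        by (rule MVT2[OF neg], rule de, rule r1(2)) (use h in auto)
      then obtain z where "h < z" "z < 0" "e 0 - e h = (0 - h) * e' z" by blast
      with e0 have "\<bar>z\<bar> < \<bar>h\<bar> \<and> z \<noteq> 0 \<and> e h = h * e' z" by simp
      then show ?thesis by blast
    qed
    then obtain z where z: "\<bar>z\<bar> < \<bar>h\<bar>" "z \<noteq> 0" "e h = h * e' z" by blast
    have "norm (e' z) \<le> C * norm (z ^ n)"
      using z h by (intro r2(2)) auto
    also have "\<dots> \<le> C * norm (h ^ n)"
      using z C(1) by (auto simp: power_abs intro!: mult_left_mono power_mono)
    finally show ?thesis
      using mult_left_mono[of _ _ "\<bar>h\<bar>"] z(3) by (fastforce simp: abs_mult mult.left_commute)
  qed
  then have "\<forall>\<^sub>F h in at 0. norm (e h) \<le> C * norm (h ^ Suc n)"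
    unfolding eventually_at using r1(1) r2(1) by (intro exI[of _ "min r1 r2"]) auto
  then show ?thesis
    unfolding expands_def e_def[symmetric] by (rule bigoI)
qed

lemma expands_divide_X:
  assumes "expands w (Suc n) W" "fps_nth W 0 = 0"
  shows "expands (\<lambda>h. w h / h) n (fps_shift 1 W)"
proof -
  have "(\<lambda>h. (w h - (\<Sum>k<Suc n. fps_nth W k * h ^ k)) / h) \<in> O[at 0](\<lambda>h. h ^ Suc n / h)"
    using assms(1) unfolding expands_def
    by (intro landau_o.big.divide_right) (auto simp: eventually_at_filter)
  moreover have "O[at 0](\<lambda>h::real. h ^ Suc n / h) = O[at 0](\<lambda>h. h ^ n)"
    by (rule landau_o.big.cong) (auto simp: eventually_at_filter)
  moreover have "(w h - (\<Sum>k<Suc n. fps_nth W k * h ^ k)) / h = w h / h - (\<Sum>k<n. fps_nth (fps_shift 1 W) k * h ^ k)"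
    if "h \<noteq> 0" for h
    using that assms(2)
    by (simp add: sum.lessThan_Suc_shift diff_divide_distrib sum_divide_distrib del: sum.lessThan_Suc)
  then have ev: "\<forall>\<^sub>F h in at 0. (w h - (\<Sum>k<Suc n. fps_nth W k * h ^ k)) / h = w h / h - (\<Sum>k<n. fps_nth (fps_shift 1 W) k * h ^ k)"
    by (auto simp: eventually_at_filter)
  ultimately show ?thesis
    unfolding expands_def landau_o.big.in_cong[OF ev] by (simp only:)
qed

lemma expands_deriv:
  assumes "expands g 2 G" "g 0 = fps_nth G 0"
  shows "(g has_real_derivative fps_nth G 1) (at 0)"
proof -
  have "expands (\<lambda>h. g h - g 0) 2 (G - fps_const (g 0))"
    by (intro expands_diff assms expands_const)
  then have "expands (\<lambda>h. (g h - g 0) / h) (Suc 0) (fps_shift 1 (G - fps_const (g 0)))"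
    by (intro expands_divide_X) (use assms in \<open>simp_all add: numeral_2_eq_2\<close>)
  then have "(\<lambda>h. (g h - g 0) / h - fps_nth G 1) \<in> O[at 0](\<lambda>h. h)"
    by (simp add: expands_def)
  moreover have "(\<lambda>h::real. h) \<in> o[at 0](\<lambda>_. 1)"
    by (intro smalloI_tendsto) (auto intro!: tendsto_eq_intros)
  ultimately have "(\<lambda>h. (g h - g 0) / h - fps_nth G 1) \<in> o[at 0](\<lambda>_. 1)"
    by (rule landau_o.big_small_trans)
  then have "((\<lambda>h. (g h - g 0) / h - fps_nth G 1) \<longlongrightarrow> 0) (at 0)"
    by (auto dest: smalloD_tendsto)
  then show ?thesis
    by (simp add: DERIV_def Lim_null[symmetric])
qed

section \<open>Taylor's theorem in two variables\<close>

lemma Ck_on_d_t_funpow: "Ck_on m D f \<Longrightarrow> i \<le> m \<Longrightarrow> Ck_on (m - i) D ((d_t ^^ i) f)"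
proof (induction i)
  case (Suc i)
  then show ?case
    by (cases "m - i") (auto simp flip: Suc_diff_Suc)
qed simp

lemma Ck_on_pd:
  assumes "Ck_on m D f" "i + j \<le> m"
  shows "Ck_on (m - (i + j)) D (pd i j f)"
  using assms(2)
proof (induction j)
  case 0
  then show ?case using Ck_on_d_t_funpow[OF assms(1)] by (simp add: pd_def)
next
  case (Suc j)
  then have "Ck_on (Suc (m - (i + Suc j))) D (pd i j f)"
    by (simp add: Suc_diff_Suc)
  then show ?case by (simp add: pd_def)
qed

lemma Ck_on_continuous: "Ck_on m D f \<Longrightarrow> continuous_on D (\<lambda>(t, y). f t y)"
  by (cases m) auto

lemma DERIV_d_t:
  assumes "Ck_on m D f" "i < m" "(s, y) \<in> D"
  shows "((\<lambda>s. (d_t ^^ i) f s y) has_real_derivative (d_t ^^ Suc i) f s y) (at s)"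
proof -
  have "Ck_on (Suc (m - Suc i)) D ((d_t ^^ i) f)"
    using Ck_on_d_t_funpow[OF assms(1), of i] assms(2) by (simp add: Suc_diff_Suc)
  then have "(\<lambda>s. (d_t ^^ i) f s y) differentiable (at s)"
    using assms(3) by auto
  then show ?thesis
    by (simp add: d_t_def DERIV_deriv_iff_real_differentiable)
qed

lemma DERIV_d_u:
  assumes "Ck_on m D f" "i + j < m" "(s, y) \<in> D"
  shows "((\<lambda>z. pd i j f s z) has_real_derivative pd i (Suc j) f s y) (at y)"
proof -
  have "Ck_on (Suc (m - Suc (i + j))) D (pd i j f)"
    using Ck_on_pd[OF assms(1), of i j] assms(2) by (simp add: Suc_diff_Suc)
  then have "(\<lambda>z. pd i j f s z) differentiable (at y)"
    using assms(3) by auto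
  then show ?thesis
    by (simp add: pd_def d_u_def DERIV_deriv_iff_real_differentiable)
qed

lemma abs_divide_fact_le: "\<bar>a / fact k\<bar> \<le> \<bar>a :: real\<bar>"
  by (simp add: abs_divide divide_le_eq mult_le_cancel_left1)

lemma Taylor_remainder_bound:
  fixes \<phi> :: "nat \<Rightarrow> real \<Rightarrow> real"
  assumes "\<And>k s. k < m \<Longrightarrow> \<bar>s\<bar> \<le> \<bar>x\<bar> \<Longrightarrow> (\<phi> k has_real_derivative \<phi> (Suc k) s) (at s)"
    and "\<And>s. \<bar>s\<bar> \<le> \<bar>x\<bar> \<Longrightarrow> \<bar>\<phi> m s\<bar> \<le> K"
  shows "\<bar>\<phi> 0 x - (\<Sum>k<m. \<phi> k 0 / fact k * x ^ k)\<bar> \<le> K * \<bar>x\<bar> ^ m"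
proof -
  obtain s where s: "\<bar>s\<bar> \<le> \<bar>x\<bar>" "\<phi> 0 x = (\<Sum>k<m. \<phi> k 0 / fact k * x ^ k) + \<phi> m s / fact m * x ^ m"
    using Maclaurin_bi_le[of \<phi> "\<phi> 0" m x] assms(1) by blast
  have "\<bar>\<phi> m s / fact m\<bar> \<le> \<bar>\<phi> m s\<bar>"
    by (rule abs_divide_fact_le)
  also have "\<dots> \<le> K" by (rule assms(2)[OF s(1)])
  finally have "\<bar>\<phi> m s / fact m\<bar> * \<bar>x\<bar> ^ m \<le> K * \<bar>x\<bar> ^ m"
    by (rule mult_right_mono) simp
  then show ?thesis
    by (simp add: s(2) abs_mult power_abs)
qed

text \<open>
  Expanding in the first variable with the second one held at \<open>v + z\<close>, and then each coefficient in
  the second variable, meets the partial derivatives only in the order of differentiation that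
  \<open>pd\<close> prescribes. The remainders are bounded by the derivatives of total order \<open>m\<close> on a compact box.
\<close>

lemma Taylor_two_variables:
  assumes "open D" "(t, v) \<in> D" "Ck_on m D f"
  obtains r K where "r > 0" "K \<ge> 0"
    "\<And>x z. \<bar>x\<bar> \<le> r \<Longrightarrow> \<bar>z\<bar> \<le> r \<Longrightarrow>
      \<bar>f (t + x) (v + z) - (\<Sum>i<m. \<Sum>j<m - i. pd i j f t v / (fact i * fact j) * x ^ i * z ^ j)\<bar>
        \<le> K * (\<bar>x\<bar> + \<bar>z\<bar>) ^ m"
proof -
  obtain e where e: "e > 0" "ball (t, v) e \<subseteq> D"
    using assms(1,2) openE by blast
  define r where "r = e / 3"
  define B where "B = {t - r..t + r} \<times> {v - r..v + r}"
  have "r > 0" using e(1) by (simp add: r_def)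
  have BD: "B \<subseteq> D"
  proof
    fix p assume "p \<in> B"
    then obtain s y where p: "p = (s, y)" "\<bar>s - t\<bar> \<le> r" "\<bar>y - v\<bar> \<le> r"
      by (cases p) (auto simp: B_def)
    have "dist (s, y) (t, v) \<le> \<bar>s - t\<bar> + \<bar>y - v\<bar>"
      unfolding dist_Pair_Pair dist_real_def by (rule order_trans[OF sqrt_sum_squares_le_sum_abs]) simp
    also have "\<dots> < e" using p \<open>r > 0\<close> by (simp add: r_def)
    finally show "p \<in> D" using e(2) p by (auto simp: dist_commute)
  qed
  have "\<exists>K. \<forall>(s, y) \<in> B. \<bar>pd i (m - i) f s y\<bar> \<le> K" if "i \<le> m" for i
  proof -
    have "continuous_on B (\<lambda>(s, y). pd i (m - i) f s y)"
      using Ck_on_continuous[OF Ck_on_pd[OF assms(3), of i "m - i"]] that BD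
      by (auto intro: continuous_on_subset)
    moreover have "compact B"
      unfolding B_def by (intro compact_Times compact_Icc)
    ultimately have "bounded ((\<lambda>(s, y). pd i (m - i) f s y) ` B)"
      by (intro compact_imp_bounded compact_continuous_image)
    then show ?thesis
      by (force simp: bounded_iff)
  qed
  then have "\<forall>i. \<exists>K. i \<le> m \<longrightarrow> (\<forall>(s, y) \<in> B. \<bar>pd i (m - i) f s y\<bar> \<le> K)"
    by blast
  from choice[OF this] obtain K where K: "\<And>i s y. i \<le> m \<Longrightarrow> (s, y) \<in> B \<Longrightarrow> \<bar>pd i (m - i) f s y\<bar> \<le> K i"
    by fast
  define L where "L = (\<Sum>i\<le>m. \<bar>K i\<bar>)"
  have KL: "K i \<le> L" if "i \<le> m" for i
    using member_le_sum[of i "{..m}" "\<lambda>i. \<bar>K i\<bar>"] that by (simp add: L_def)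
  have bound: "\<bar>pd i (m - i) f s y\<bar> \<le> L" if "i \<le> m" "(s, y) \<in> B" for i s y
    using K[OF that] KL[OF that(1)] by linarith
  have "L \<ge> 0" by (simp add: L_def sum_nonneg)
  show ?thesis
  proof (rule that[of r "L + (\<Sum>i<m. L)"])
    fix x z :: real assume xz: "\<bar>x\<bar> \<le> r" "\<bar>z\<bar> \<le> r"
    define g where "g i = (d_t ^^ i) f t (v + z)" for i
    have inB: "(t + s, v + y) \<in> B" if "\<bar>s\<bar> \<le> r" "\<bar>y\<bar> \<le> r" for s y
      using that by (auto simp: B_def)
    have step_t: "\<bar>f (t + x) (v + z) - (\<Sum>i<m. g i / fact i * x ^ i)\<bar> \<le> L * \<bar>x\<bar> ^ m"
    proof -
      have "\<bar>(d_t ^^ 0) f (t + x) (v + z) - (\<Sum>i<m. (d_t ^^ i) f (t + 0) (v + z) / fact i * x ^ i)\<bar> \<le> L * \<bar>x\<bar> ^ m"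
      proof (rule Taylor_remainder_bound[where \<phi> = "\<lambda>i s. (d_t ^^ i) f (t + s) (v + z)"])
        show "((\<lambda>s. (d_t ^^ k) f (t + s) (v + z)) has_real_derivative (d_t ^^ Suc k) f (t + s) (v + z)) (at s)"
          if "k < m" "\<bar>s\<bar> \<le> \<bar>x\<bar>" for k s
          using DERIV_d_t[OF assms(3) that(1), of "t + s" "v + z"] inB[of s z] BD that xz
          by (simp add: DERIV_shift add.commute[of t] subset_iff)
        show "\<bar>(d_t ^^ m) f (t + s) (v + z)\<bar> \<le> L" if "\<bar>s\<bar> \<le> \<bar>x\<bar>" for s
          using bound[of m "t + s" "v + z"] inB[of s z] that xz by (simp add: pd_def)
      qed
      then show ?thesis by (simp add: g_def)
    qed
    have step_u: "\<bar>g i - (\<Sum>j<m - i. pd i j f t v / fact j * z ^ j)\<bar> \<le> L * \<bar>z\<bar> ^ (m - i)" if "i < m" for i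
    proof -
      have "\<bar>pd i 0 f t (v + z) - (\<Sum>j<m - i. pd i j f t (v + 0) / fact j * z ^ j)\<bar> \<le> L * \<bar>z\<bar> ^ (m - i)"
      proof (rule Taylor_remainder_bound[where \<phi> = "\<lambda>j y. pd i j f t (v + y)"])
        show "((\<lambda>y. pd i k f t (v + y)) has_real_derivative pd i (Suc k) f t (v + y)) (at y)"
          if "k < m - i" "\<bar>y\<bar> \<le> \<bar>z\<bar>" for k y
          using DERIV_d_u[OF assms(3), of i k t "v + y"] inB[of 0 y] BD that xz \<open>r > 0\<close>
          by (simp add: DERIV_shift add.commute[of v] subset_iff)
        show "\<bar>pd i (m - i) f t (v + y)\<bar> \<le> L" if "\<bar>y\<bar> \<le> \<bar>z\<bar>" for y
          using bound[of i t "v + y"] inB[of 0 y] that xz \<open>i < m\<close> \<open>r > 0\<close> by simp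
      qed
      then show ?thesis by (simp add: g_def pd_def)
    qed
    have mono: "L * \<bar>x\<bar> ^ i * \<bar>z\<bar> ^ (m - i) \<le> L * (\<bar>x\<bar> + \<bar>z\<bar>) ^ m" if "i \<le> m" for i
    proof -
      have "\<bar>x\<bar> ^ i * \<bar>z\<bar> ^ (m - i) \<le> (\<bar>x\<bar> + \<bar>z\<bar>) ^ i * (\<bar>x\<bar> + \<bar>z\<bar>) ^ (m - i)"
        by (intro mult_mono power_mono) auto
      also have "\<dots> = (\<bar>x\<bar> + \<bar>z\<bar>) ^ m"
        using that by (simp flip: power_add)
      finally show ?thesis
        using \<open>L \<ge> 0\<close> by (simp add: mult.assoc mult_left_mono)
    qed
    have "\<bar>f (t + x) (v + z) - (\<Sum>i<m. \<Sum>j<m - i. pd i j f t v / (fact i * fact j) * x ^ i * z ^ j)\<bar>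
      = \<bar>(f (t + x) (v + z) - (\<Sum>i<m. g i / fact i * x ^ i))
         + (\<Sum>i<m. (g i - (\<Sum>j<m - i. pd i j f t v / fact j * z ^ j)) / fact i * x ^ i)\<bar>"
      by (simp add: algebra_simps diff_divide_distrib sum_subtractf sum_distrib_left sum_divide_distrib)
    also have "\<dots> \<le> L * \<bar>x\<bar> ^ m + (\<Sum>i<m. L * (\<bar>x\<bar> + \<bar>z\<bar>) ^ m)"
    proof (intro order_trans[OF abs_triangle_ineq] add_mono step_t order_trans[OF sum_abs] sum_mono)
      fix i assume "i \<in> {..<m}"
      then have i: "i < m" by simp
      have "\<bar>(g i - (\<Sum>j<m - i. pd i j f t v / fact j * z ^ j)) / fact i * x ^ i\<bar>
        \<le> \<bar>g i - (\<Sum>j<m - i. pd i j f t v / fact j * z ^ j)\<bar> * \<bar>x\<bar> ^ i"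
        unfolding abs_mult power_abs by (rule mult_right_mono[OF abs_divide_fact_le]) simp
      also have "\<dots> \<le> L * \<bar>z\<bar> ^ (m - i) * \<bar>x\<bar> ^ i"
        by (intro mult_right_mono step_u i) simp
      also have "\<dots> \<le> L * (\<bar>x\<bar> + \<bar>z\<bar>) ^ m"
        using mono[of i] i by (simp add: mult_ac)
      finally show "\<bar>(g i - (\<Sum>j<m - i. pd i j f t v / fact j * z ^ j)) / fact i * x ^ i\<bar>
        \<le> L * (\<bar>x\<bar> + \<bar>z\<bar>) ^ m" .
    qed
    also have "\<dots> \<le> (L + (\<Sum>i<m. L)) * (\<bar>x\<bar> + \<bar>z\<bar>) ^ m"
      using mono[of m] by (simp add: algebra_simps)
    finally show "\<bar>f (t + x) (v + z) - (\<Sum>i<m. \<Sum>j<m - i. pd i j f t v / (fact i * fact j) * x ^ i * z ^ j)\<bar>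
        \<le> (L + (\<Sum>i<m. L)) * (\<bar>x\<bar> + \<bar>z\<bar>) ^ m" .
  qed (use \<open>r > 0\<close> \<open>L \<ge> 0\<close> in \<open>auto intro: sum_nonneg add_nonneg_nonneg\<close>)
qed

section \<open>Substituting expansions into a function of two variables\<close>

text \<open>
  The Taylor polynomial of degree below \<open>m\<close>, with partial derivatives \<open>F\<close>, evaluated at the
  displacement \<open>(c h, W(h))\<close>.
\<close>

definition taylor_fps :: "nat \<Rightarrow> (nat \<Rightarrow> nat \<Rightarrow> real) \<Rightarrow> real \<Rightarrow> real fps \<Rightarrow> real fps" where
  "taylor_fps m F c W =
    (\<Sum>i<m. \<Sum>j<m - i. fps_const (F i j / (fact i * fact j)) * (fps_const c * fps_X) ^ i * W ^ j)"

text \<open>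
  As \<open>w\<close> has no constant term, the displacement \<open>(c h, w(h))\<close> is \<open>O(h)\<close>, which makes the Taylor
  remainder of degree \<open>m\<close> an \<open>O(h\<^sup>m)\<close>; the Taylor polynomial is handled by the sum and product rules.
\<close>

lemma expands_compose:
  assumes "open D" "(t, v) \<in> D" "Ck_on m D f"
    and w: "expands w n W" "fps_nth W 0 = 0" "1 \<le> n" "n \<le> m"
  shows "expands (\<lambda>h. f (t + c * h) (v + w h)) n (taylor_fps m (\<lambda>i j. pd i j f t v) c W)"
proof -
  obtain r K where rK: "r > 0" "K \<ge> 0"
    "\<And>x z. \<bar>x\<bar> \<le> r \<Longrightarrow> \<bar>z\<bar> \<le> r \<Longrightarrow>
      \<bar>f (t + x) (v + z) - (\<Sum>i<m. \<Sum>j<m - i. pd i j f t v / (fact i * fact j) * x ^ i * z ^ j)\<bar>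
        \<le> K * (\<bar>x\<bar> + \<bar>z\<bar>) ^ m"
    using Taylor_two_variables[OF assms(1-3)] by blast
  let ?P = "\<lambda>h. \<Sum>i<m. \<Sum>j<m - i. pd i j f t v / (fact i * fact j) * (c * h) ^ i * w h ^ j"
  have "expands ?P n (taylor_fps m (\<lambda>i j. pd i j f t v) c W)"
    unfolding taylor_fps_def
    by (intro expands_sum expands_mult expands_power expands_const expands_X w(1))
  moreover have "(\<lambda>h. f (t + c * h) (v + w h) - ?P h) \<in> O[at 0](\<lambda>h. h ^ n)"
  proof -
    obtain C where C: "C > 0" "\<forall>\<^sub>F h in at 0. norm (w h) \<le> C * norm h"
      using expands_bigo_h[OF w(1,3,2)] by (elim landau_o.bigE)
    have "((\<lambda>h::real. c * h) \<longlongrightarrow> 0) (at 0)" "((\<lambda>h::real. C * h) \<longlongrightarrow> 0) (at 0)"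
      by (auto intro!: tendsto_eq_intros)
    then have "\<forall>\<^sub>F h in at 0. \<bar>c * h\<bar> < r" "\<forall>\<^sub>F h in at 0. \<bar>C * h\<bar> < r"
      using rK(1) by (auto dest!: tendstoD simp: dist_real_def)
    with C(2) have "\<forall>\<^sub>F h in at 0. norm (f (t + c * h) (v + w h) - ?P h) \<le> (K * (\<bar>c\<bar> + C) ^ m) * norm (h ^ m)"
    proof eventually_elim
      case (elim h)
      have "norm (f (t + c * h) (v + w h) - ?P h) \<le> K * (\<bar>c * h\<bar> + \<bar>w h\<bar>) ^ m"
        unfolding real_norm_def using elim C(1) by (intro rK(3)) (auto simp: abs_mult)
      also have "\<dots> \<le> K * ((\<bar>c\<bar> + C) * \<bar>h\<bar>) ^ m"
        using elim(1) rK(2) by (intro mult_left_mono power_mono) (auto simp: abs_mult algebra_simps)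
      finally show ?case
        by (simp add: power_mult_distrib power_abs mult.assoc)
    qed
    then have "(\<lambda>h. f (t + c * h) (v + w h) - ?P h) \<in> O[at 0](\<lambda>h. h ^ m)"
      by (rule bigoI)
    then show ?thesis
      using power_bigo_power_at_0[OF w(4)] by (rule landau_o.big_trans)
  qed
  ultimately show ?thesis
    by (rule expands_perturb)
qed

section \<open>The exact solution\<close>

text \<open>
  This triangular dependence is what makes Picard iteration stabilise one more coefficient in each step.
\<close>

lemma taylor_fps_nth_cong:
  assumes "\<And>j. j \<le> k \<Longrightarrow> fps_nth V j = fps_nth W j"
  shows "fps_nth (taylor_fps m F c V) k = fps_nth (taylor_fps m F c W) k"
proof -
  have pow: "l \<le> k \<Longrightarrow> fps_nth (V ^ j) l = fps_nth (W ^ j) l" for j l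
  proof (induction j arbitrary: l)
    case (Suc j)
    then show ?case
      using assms by (auto simp: fps_mult_nth intro!: sum.cong)
  qed simp
  show ?thesis
    unfolding taylor_fps_def fps_sum_nth
    by (intro sum.cong refl) (auto simp: fps_mult_nth[of _ "_ ^ _"] pow intro!: sum.cong)
qed

text \<open>
  Picard iteration on power series, starting from \<open>0\<close>. The \<open>n\<close>-th iterate is correct up to
  \<open>O(h\<^sup>n\<^sup>+\<^sup>1)\<close>, and its coefficients up to \<open>n\<close> no longer change, so the \<open>m\<close>-th one satisfies
  the differential equation coefficientwise below \<open>m\<close>.
\<close>

lemma exact_solution_expands:
  assumes D: "open D" "(t, u t) \<in> D" "Ck_on m D f"
    and sol: "\<forall>\<^sub>F s in nhds t. (u has_real_derivative f s (u s)) (at s)"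
  obtains U where "expands (\<lambda>h. u (t + h) - u t) (Suc m) U" "fps_nth U 0 = 0"
    "\<And>k. k < m \<Longrightarrow>
      real (Suc k) * fps_nth U (Suc k) = fps_nth (taylor_fps m (\<lambda>i j. pd i j f t (u t)) 1 U) k"
proof -
  define w where "w h = u (t + h) - u t" for h
  define T where "T = taylor_fps m (\<lambda>i j. pd i j f t (u t)) 1"
  define W where "W n = ((\<lambda>V. fps_integral0 (T V)) ^^ n) 0" for n
  have W_0: "W 0 = 0" and W_Suc: "W (Suc n) = fps_integral0 (T (W n))" for n
    by (simp_all add: W_def)
  have W_nth_0: "fps_nth (W n) 0 = 0" for n
    by (cases n) (simp_all add: W_0 W_Suc)
  have deriv_w: "\<forall>\<^sub>F h in nhds 0. (w has_real_derivative f (t + 1 * h) (u t + w h)) (at h)"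
  proof -
    obtain d where d: "d > 0" "\<And>s. dist s t < d \<Longrightarrow> (u has_real_derivative f s (u s)) (at s)"
      using sol unfolding eventually_nhds_metric by blast
    have "(w has_real_derivative f (t + 1 * h) (u t + w h)) (at h)" if "dist h 0 < d" for h
      using d(2)[of "t + h"] that unfolding w_def
      by (auto intro!: derivative_eq_intros simp: DERIV_shift add.commute[of t] dist_real_def)
    then show ?thesis
      unfolding eventually_nhds_metric using d(1) by blast
  qed
  have expands_W: "expands w (Suc n) (W n)" if "n \<le> m" for n
    using that
  proof (induction n)
    case 0
    have "(w has_real_derivative f (t + 1 * 0) (u t + w 0)) (at 0)"
      using deriv_w by (rule eventually_nhds_x_imp_x)
    then have "((\<lambda>h. w h / h) \<longlongrightarrow> f t (u t)) (at 0)"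
      by (simp add: DERIV_def w_def)
    then have "w \<in> O[at 0](\<lambda>h. h)"
      by (rule bigoI_tendsto) (auto simp: eventually_at_filter)
    then show ?case
      by (simp add: expands_def W_0)
  next
    case (Suc n)
    then have "expands (\<lambda>h. f (t + 1 * h) (u t + w h)) (Suc n) (T (W n))"
      unfolding T_def by (intro expands_compose[OF D] W_nth_0) auto
    moreover have "w 0 = 0" by (simp add: w_def)
    ultimately show ?case
      unfolding W_Suc by (rule expands_integral[OF deriv_w])
  qed
  \<comment> \<open>Coefficient \<open>j\<close> of an integral uses coefficient \<open>j - 1\<close> of the integrand, hence only
    coefficients up to \<open>j - 1\<close> of the previous iterate.\<close>
  have stable: "j \<le> n \<Longrightarrow> fps_nth (W n) j = fps_nth (W (Suc n)) j" for n j
  proof (induction n arbitrary: j)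
    case (Suc n)
    then show ?case
      by (cases j) (auto simp: W_Suc[of n] W_Suc[of "Suc n"] T_def intro!: taylor_fps_nth_cong)
  qed (simp add: W_nth_0)
  have "real (Suc k) * fps_nth (W m) (Suc k) = fps_nth (T (W m)) k" if "k < m" for k
    using stable[of "Suc k" m] that by (simp add: W_Suc field_simps)
  then show ?thesis
    using that[of "W m"] expands_W[OF order_refl] W_nth_0 unfolding w_def T_def by blast
qed

lemma second_derivative_exact:
  assumes D: "open D" "(t, u t) \<in> D" "Ck_on 5 D f"
    and sol: "\<forall>\<^sub>F s in nhds t. (u has_real_derivative f s (u s)) (at s)"
    and U: "expands (\<lambda>h. u (t + h) - u t) 2 U" "fps_nth U 0 = 0"
  shows "(deriv ^^ 2) u t = fps_nth (taylor_fps 5 (\<lambda>i j. pd i j f t (u t)) 1 U) 1"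
proof -
  let ?T = "taylor_fps 5 (\<lambda>i j. pd i j f t (u t)) 1 U"
  have "expands (\<lambda>h. f (t + 1 * h) (u t + (u (t + h) - u t))) 2 ?T"
    by (intro expands_compose[OF D U]) auto
  then have "expands (\<lambda>h. f (t + h) (u (t + h))) 2 ?T" by simp
  moreover have "fps_nth ?T 0 = f t (u t)"
  proof -
    have "fps_nth ?T 0 = fps_nth (taylor_fps 5 (\<lambda>i j. pd i j f t (u t)) 1 0) 0"
      by (rule taylor_fps_nth_cong) (simp add: U)
    also have "\<dots> = f t (u t)"
      by (simp add: taylor_fps_def fps_sum_nth eval_nat_numeral pd_def)
    finally show ?thesis .
  qed
  ultimately have "((\<lambda>h. f (t + h) (u (t + h))) has_real_derivative fps_nth ?T 1) (at 0)"
    by (intro expands_deriv) auto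
  then have "((\<lambda>s. f s (u s)) has_real_derivative fps_nth ?T 1) (at t)"
    using DERIV_shift[of "\<lambda>s. f s (u s)" "fps_nth ?T 1" 0 t] by (simp add: add.commute)
  moreover have "deriv (deriv u) t = deriv (\<lambda>s. f s (u s)) t"
    by (rule deriv_cong_ev) (use sol in \<open>auto elim!: eventually_mono dest: DERIV_imp_deriv\<close>)
  ultimately show ?thesis
    by (simp add: numeral_2_eq_2 DERIV_imp_deriv)
qed

section \<open>Coefficients up to the fourth order\<close>

lemma taylor_fps_5_nth:
  assumes "fps_nth W 0 = 0"
  shows "fps_nth (taylor_fps 5 F c W) 0 = F 0 0"
    "fps_nth (taylor_fps 5 F c W) 1 = F 1 0 * c + F 0 1 * fps_nth W 1"
    "fps_nth (taylor_fps 5 F c W) 2 =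
       F 2 0 * c^2 / 2 + F 1 1 * c * fps_nth W 1 + F 0 2 * fps_nth W 1 ^ 2 / 2 + F 0 1 * fps_nth W 2"
    "fps_nth (taylor_fps 5 F c W) 3 =
       F 3 0 * c^3 / 6 + F 2 1 * c^2 * fps_nth W 1 / 2 + F 1 2 * c * fps_nth W 1 ^ 2 / 2 + F 0 3 * fps_nth W 1 ^ 3 / 6
       + (F 1 1 * c + F 0 2 * fps_nth W 1) * fps_nth W 2 + F 0 1 * fps_nth W 3"
    "fps_nth (taylor_fps 5 F c W) 4 =
       F 4 0 * c^4 / 24 + F 3 1 * c^3 * fps_nth W 1 / 6 + F 2 2 * c^2 * fps_nth W 1 ^ 2 / 4
       + F 1 3 * c * fps_nth W 1 ^ 3 / 6 + F 0 4 * fps_nth W 1 ^ 4 / 24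
       + (F 2 1 * c^2 / 2 + F 1 2 * c * fps_nth W 1 + F 0 3 * fps_nth W 1 ^ 2 / 2) * fps_nth W 2
       + F 0 2 * fps_nth W 2 ^ 2 / 2 + (F 1 1 * c + F 0 2 * fps_nth W 1) * fps_nth W 3 + F 0 1 * fps_nth W 4"
proof -
  have W2: "fps_nth (W ^ 2) k = (\<Sum>i\<le>k. fps_nth W i * fps_nth W (k - i))" for k
    by (simp add: power2_eq_square fps_mult_nth atLeast0AtMost)
  have W3: "fps_nth (W ^ 3) k = (\<Sum>i\<le>k. fps_nth W i * fps_nth (W ^ 2) (k - i))" for k
    by (simp add: power3_eq_cube power2_eq_square fps_mult_nth atLeast0AtMost mult.assoc)
  have W4: "fps_nth (W ^ 4) k = (\<Sum>i\<le>k. fps_nth W i * fps_nth (W ^ 3) (k - i))" for k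
  proof -
    have "W ^ 4 = W * W ^ 3" by (simp add: eval_nat_numeral)
    then show ?thesis by (simp add: fps_mult_nth atLeast0AtMost)
  qed
  have T: "taylor_fps 5 F c W = (\<Sum>i<5. \<Sum>j<5 - i. fps_const (F i j / (fact i * fact j) * c ^ i) * (fps_X ^ i * W ^ j))"
    by (simp add: taylor_fps_def power_mult_distrib fps_const_power mult.assoc
        del: times_divide_eq_left times_divide_eq_right flip: fps_const_mult)
  note expand = T lessThan_nat_numeral lessThan_Suc fps_sum_nth fps_X_power_mult_nth W2 W3 W4 assms
    atMost_nat_numeral atMost_Suc fact_numeral
  show "fps_nth (taylor_fps 5 F c W) 0 = F 0 0"
    "fps_nth (taylor_fps 5 F c W) 1 = F 1 0 * c + F 0 1 * fps_nth W 1"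
    "fps_nth (taylor_fps 5 F c W) 2 =
       F 2 0 * c^2 / 2 + F 1 1 * c * fps_nth W 1 + F 0 2 * fps_nth W 1 ^ 2 / 2 + F 0 1 * fps_nth W 2"
    "fps_nth (taylor_fps 5 F c W) 3 =
       F 3 0 * c^3 / 6 + F 2 1 * c^2 * fps_nth W 1 / 2 + F 1 2 * c * fps_nth W 1 ^ 2 / 2 + F 0 3 * fps_nth W 1 ^ 3 / 6
       + (F 1 1 * c + F 0 2 * fps_nth W 1) * fps_nth W 2 + F 0 1 * fps_nth W 3"
    "fps_nth (taylor_fps 5 F c W) 4 =
       F 4 0 * c^4 / 24 + F 3 1 * c^3 * fps_nth W 1 / 6 + F 2 2 * c^2 * fps_nth W 1 ^ 2 / 4
       + F 1 3 * c * fps_nth W 1 ^ 3 / 6 + F 0 4 * fps_nth W 1 ^ 4 / 24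
       + (F 2 1 * c^2 / 2 + F 1 2 * c * fps_nth W 1 + F 0 3 * fps_nth W 1 ^ 2 / 2) * fps_nth W 2
       + F 0 2 * fps_nth W 2 ^ 2 / 2 + (F 1 1 * c + F 0 2 * fps_nth W 1) * fps_nth W 3 + F 0 1 * fps_nth W 4"
    by (simp_all add: expand, simp_all add: field_simps power2_eq_square power3_eq_cube power4_eq_xxxx)
qed

text \<open>
  The value of \<open>(\<partial>\<^sub>t + \<phi> \<partial>\<^sub>u)\<^sup>n \<partial>\<^sub>u\<^sup>j f\<close>, where \<open>\<phi>\<close> is the constant \<open>F 0 0\<close>: the derivative
  along the direction of the solution, with that direction frozen.
\<close>

definition frozen_deriv :: "(nat \<Rightarrow> nat \<Rightarrow> real) \<Rightarrow> nat \<Rightarrow> nat \<Rightarrow> real" where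
  "frozen_deriv F n j = (\<Sum>i\<le>n. real (n choose i) * F (n - i) (i + j) * F 0 0 ^ i)"

lemma frozen_deriv_unfold:
  "frozen_deriv F 1 0 = F 1 0 + F 0 1 * F 0 0"
  "frozen_deriv F 2 0 = F 2 0 + 2 * F 1 1 * F 0 0 + F 0 2 * F 0 0 ^ 2"
  "frozen_deriv F 3 0 = F 3 0 + 3 * F 2 1 * F 0 0 + 3 * F 1 2 * F 0 0 ^ 2 + F 0 3 * F 0 0 ^ 3"
  "frozen_deriv F 4 0 = F 4 0 + 4 * F 3 1 * F 0 0 + 6 * F 2 2 * F 0 0 ^ 2 + 4 * F 1 3 * F 0 0 ^ 3
     + F 0 4 * F 0 0 ^ 4"
  "frozen_deriv F 1 1 = F 1 1 + F 0 2 * F 0 0"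
  "frozen_deriv F 2 1 = F 2 1 + 2 * F 1 2 * F 0 0 + F 0 3 * F 0 0 ^ 2"
  by (simp_all add: frozen_deriv_def eval_nat_numeral algebra_simps)

text \<open>
  If the displacement starts in the direction \<open>(1, f)\<close>, all contributions of its linear part
  collect into frozen derivatives.
\<close>

lemma taylor_fps_5_nth_consistent:
  assumes "fps_nth W 0 = 0" "fps_nth W 1 = c * F 0 0"
  defines "\<delta> \<equiv> frozen_deriv F"
  shows "fps_nth (taylor_fps 5 F c W) 0 = F 0 0"
    "fps_nth (taylor_fps 5 F c W) 1 = c * \<delta> 1 0"
    "fps_nth (taylor_fps 5 F c W) 2 = c^2 * \<delta> 2 0 / 2 + F 0 1 * fps_nth W 2"
    "fps_nth (taylor_fps 5 F c W) 3 = c^3 * \<delta> 3 0 / 6 + c * \<delta> 1 1 * fps_nth W 2 + F 0 1 * fps_nth W 3"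
    "fps_nth (taylor_fps 5 F c W) 4 = c^4 * \<delta> 4 0 / 24 + c^2 * \<delta> 2 1 / 2 * fps_nth W 2
       + F 0 2 / 2 * fps_nth W 2 ^ 2 + c * \<delta> 1 1 * fps_nth W 3 + F 0 1 * fps_nth W 4"
  using assms(2) unfolding \<delta>_def taylor_fps_5_nth[OF assms(1)] frozen_deriv_unfold
  by (simp_all add: field_simps power2_eq_square power3_eq_cube power4_eq_xxxx)

lemma exact_coefficients:
  assumes "fps_nth U 0 = 0"
    and "\<forall>k<5. real (Suc k) * fps_nth U (Suc k) = fps_nth (taylor_fps 5 F 1 U) k"
  defines "\<delta> \<equiv> frozen_deriv F"
  shows "fps_nth U 1 = F 0 0"
    "fps_nth U 2 = \<delta> 1 0 / 2"
    "fps_nth U 3 = \<delta> 2 0 / 6 + F 0 1 * \<delta> 1 0 / 6"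
    "fps_nth U 4 = \<delta> 3 0 / 24 + \<delta> 1 1 * \<delta> 1 0 / 8 + F 0 1 * (\<delta> 2 0 + F 0 1 * \<delta> 1 0) / 24"
    "fps_nth U 5 = \<delta> 4 0 / 120 + \<delta> 2 1 * \<delta> 1 0 / 20 + F 0 2 * \<delta> 1 0 ^ 2 / 40
       + \<delta> 1 1 * (\<delta> 2 0 + F 0 1 * \<delta> 1 0) / 30
       + F 0 1 * (\<delta> 3 0 + 3 * \<delta> 1 1 * \<delta> 1 0 + F 0 1 * (\<delta> 2 0 + F 0 1 * \<delta> 1 0)) / 120"
proof -
  show U1: "fps_nth U 1 = F 0 0"
    using assms(2)[rule_format, of 0] by (simp add: taylor_fps_5_nth[OF assms(1)])
  then have "fps_nth U 1 = 1 * F 0 0" by simp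
  note T = taylor_fps_5_nth_consistent[where F = F, OF assms(1) this, folded \<delta>_def]
  show U2: "fps_nth U 2 = \<delta> 1 0 / 2"
    using assms(2)[rule_format, of 1] unfolding T by (simp add: eval_nat_numeral)
  show U3: "fps_nth U 3 = \<delta> 2 0 / 6 + F 0 1 * \<delta> 1 0 / 6"
    using assms(2)[rule_format, of 2] unfolding T U2 by (simp add: eval_nat_numeral)
  show U4: "fps_nth U 4 = \<delta> 3 0 / 24 + \<delta> 1 1 * \<delta> 1 0 / 8 + F 0 1 * (\<delta> 2 0 + F 0 1 * \<delta> 1 0) / 24"
    using assms(2)[rule_format, of 3] unfolding T U2 U3 by (simp add: field_simps)
  show "fps_nth U 5 = \<delta> 4 0 / 120 + \<delta> 2 1 * \<delta> 1 0 / 20 + F 0 2 * \<delta> 1 0 ^ 2 / 40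
       + \<delta> 1 1 * (\<delta> 2 0 + F 0 1 * \<delta> 1 0) / 30
       + F 0 1 * (\<delta> 3 0 + 3 * \<delta> 1 1 * \<delta> 1 0 + F 0 1 * (\<delta> 2 0 + F 0 1 * \<delta> 1 0)) / 120"
    using assms(2)[rule_format, of 4] unfolding T U2 U3 U4 by (simp add: field_simps power2_eq_square)
qed

section \<open>The numerical increment\<close>

text \<open>
  The displacement \<open>v exp(p h\<^sup>2) + h A(h) - v\<close> of the second argument in a stage, up to \<open>O(h\<^sup>5)\<close>.
\<close>

definition stage_fps :: "real \<Rightarrow> real \<Rightarrow> real fps \<Rightarrow> real fps" where
  "stage_fps v p A = fps_const (v * p) * fps_X ^ 2 + fps_const (v * p ^ 2 / 2) * fps_X ^ 4 + fps_X * A"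

lemma stage_fps_nth:
  "fps_nth (stage_fps v p A) 0 = 0"
  "fps_nth (stage_fps v p A) 1 = fps_nth A 0"
  "fps_nth (stage_fps v p A) 2 = v * p + fps_nth A 1"
  "fps_nth (stage_fps v p A) 3 = fps_nth A 2"
  "fps_nth (stage_fps v p A) 4 = v * p ^ 2 / 2 + fps_nth A 3"
  by (simp_all add: stage_fps_def fps_X_power_nth)

lemma expands_stage:
  assumes "expands A 5 G"
  shows "expands (\<lambda>h. v * exp (p * h ^ 2) + h * A h - v) 5 (stage_fps v p G)"
proof -
  have "(\<lambda>h. v * exp (p * h ^ 2) - (v + v * p * h ^ 2 + v * p ^ 2 / 2 * h ^ 4)) \<in> O[at 0](\<lambda>h. h ^ 6)"
  proof (rule bigoI)
    have "((\<lambda>h::real. p * h ^ 2) \<longlongrightarrow> 0) (at 0)"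
      by (auto intro!: tendsto_eq_intros)
    then have "\<forall>\<^sub>F h::real in at 0. \<bar>p * h ^ 2\<bar> < 1"
      by (auto dest!: tendstoD[of _ _ _ 1] simp: dist_real_def)
    then show "\<forall>\<^sub>F h in at 0. norm (v * exp (p * h ^ 2) - (v + v * p * h ^ 2 + v * p ^ 2 / 2 * h ^ 4))
        \<le> (\<bar>v\<bar> * exp 1 * \<bar>p\<bar> ^ 3) * norm (h ^ 6)"
    proof eventually_elim
      case (elim h)
      have eq: "v * exp (p * h ^ 2) - (v + v * p * h ^ 2 + v * p ^ 2 / 2 * h ^ 4)
          = v * (exp (p * h ^ 2) - (\<Sum>k<3. exp 0 / fact k * (p * h ^ 2) ^ k))"
        by (simp add: eval_nat_numeral algebra_simps)
      have "\<bar>exp (p * h ^ 2) - (\<Sum>k<3. exp 0 / fact k * (p * h ^ 2) ^ k)\<bar> \<le> exp 1 * \<bar>p * h ^ 2\<bar> ^ 3"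
        using Taylor_remainder_bound[of 3 "p * h ^ 2" "\<lambda>_. exp" "exp 1"] elim by fastforce
      from mult_left_mono[OF this, of "\<bar>v\<bar>"] show ?case
        unfolding eq real_norm_def abs_mult
        by (simp add: power_mult_distrib power_abs mult_ac flip: power_mult)
    qed
  qed
  then have "(\<lambda>h. v * exp (p * h ^ 2) - (v + v * p * h ^ 2 + v * p ^ 2 / 2 * h ^ 4)) \<in> O[at 0](\<lambda>h. h ^ 5)"
    by (rule landau_o.big_trans) (simp add: power_bigo_power_at_0)
  also have "(\<lambda>h. v * exp (p * h ^ 2) - (v + v * p * h ^ 2 + v * p ^ 2 / 2 * h ^ 4))
      = (\<lambda>h. (v * exp (p * h ^ 2) + h * A h - v) - (v * p * h ^ 2 + v * p ^ 2 / 2 * h ^ 4 + h * A h))"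
    by (rule ext) simp
  finally have "(\<lambda>h. (v * exp (p * h ^ 2) + h * A h - v) - (v * p * h ^ 2 + v * p ^ 2 / 2 * h ^ 4 + h * A h))
      \<in> O[at 0](\<lambda>h. h ^ 5)" .
  moreover have "expands (\<lambda>h. v * p * h ^ 2 + v * p ^ 2 / 2 * h ^ 4 + h * A h) 5 (stage_fps v p G)"
    unfolding stage_fps_def
    by (intro expands_add expands_mult expands_power expands_const expands_X assms)
  ultimately show ?thesis
    by (rule expands_perturb[rotated])
qed

definition increment_fps ::
  "(nat \<Rightarrow> nat \<Rightarrow> real) \<Rightarrow> (nat \<Rightarrow> nat \<Rightarrow> real) \<Rightarrow> (nat \<Rightarrow> real) \<Rightarrow> (nat \<Rightarrow> real) \<Rightarrow> (nat \<Rightarrow> real) \<Rightarrow> real \<Rightarrow> real fps" where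
  "increment_fps F a b c \<epsilon>sq v =
    (let stage = (\<lambda>i A. taylor_fps 5 F (c i) (stage_fps v (- \<epsilon>sq i * c i ^ 2) A));
         K1 = fps_const (F 0 0);
         K2 = stage 2 (fps_const (a 2 1) * K1);
         K3 = stage 3 (fps_const (a 3 1) * K1 + fps_const (a 3 2) * K2);
         K4 = stage 4 (fps_const (a 4 1) * K1 + fps_const (a 4 2) * K2 + fps_const (a 4 3) * K3)
     in fps_const (b 1) * K1 + fps_const (b 2) * K2 + fps_const (b 3) * K3 + fps_const (b 4) * K4)"

lemma expands_increment:
  assumes D: "open D" "(t, v) \<in> D" "Ck_on 5 D f"
  shows "expands (\<lambda>h. rbf_rk4_increment f a b c \<epsilon>sq t v h) 5 (increment_fps (\<lambda>i j. pd i j f t v) a b c \<epsilon>sq v)"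
proof -
  have stage: "expands (\<lambda>h. f (t + c i * h) (v * exp (- \<epsilon>sq i * (c i * h)^2) + h * A h)) 5
      (taylor_fps 5 (\<lambda>i j. pd i j f t v) (c i) (stage_fps v (- \<epsilon>sq i * c i ^ 2) G))"
    if "expands A 5 G" for i A G
    using expands_compose[OF D expands_stage[OF that, of v "- \<epsilon>sq i * c i ^ 2"], of "c i"]
    by (simp add: stage_fps_nth power_mult_distrib mult.assoc)
  have k1: "expands (\<lambda>_. f t v) 5 (fps_const (pd 0 0 f t v))"
    using expands_const[of "f t v"] by (simp add: pd_def)
  show ?thesis
    unfolding rbf_rk4_increment_def increment_fps_def Let_def
    by (intro expands_add expands_mult expands_const stage k1)
qed

lemma stage_coefficients:
  fixes F :: "nat \<Rightarrow> nat \<Rightarrow> real" and c v p :: real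
  assumes "fps_nth A 0 = c * F 0 0"
  defines "\<delta> \<equiv> frozen_deriv F"
    and "K \<equiv> taylor_fps 5 F c (stage_fps v p A)"
  shows "fps_nth K 0 = F 0 0"
    "fps_nth K 1 = c * \<delta> 1 0"
    "fps_nth K 2 = c^2 * \<delta> 2 0 / 2 + F 0 1 * (v * p + fps_nth A 1)"
    "fps_nth K 3 = c^3 * \<delta> 3 0 / 6 + c * \<delta> 1 1 * (v * p + fps_nth A 1) + F 0 1 * fps_nth A 2"
    "fps_nth K 4 = c^4 * \<delta> 4 0 / 24 + c^2 * \<delta> 2 1 / 2 * (v * p + fps_nth A 1)
       + F 0 2 / 2 * (v * p + fps_nth A 1) ^ 2 + c * \<delta> 1 1 * fps_nth A 2 + F 0 1 * (v * p ^ 2 / 2 + fps_nth A 3)"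
proof -
  have "fps_nth (stage_fps v p A) 1 = c * F 0 0"
    unfolding stage_fps_nth by (rule assms(1))
  note K = taylor_fps_5_nth_consistent[where F = F, OF stage_fps_nth(1) this, folded \<delta>_def K_def,
      unfolded stage_fps_nth]
  show "fps_nth K 0 = F 0 0"
    "fps_nth K 1 = c * \<delta> 1 0"
    "fps_nth K 2 = c^2 * \<delta> 2 0 / 2 + F 0 1 * (v * p + fps_nth A 1)"
    "fps_nth K 3 = c^3 * \<delta> 3 0 / 6 + c * \<delta> 1 1 * (v * p + fps_nth A 1) + F 0 1 * fps_nth A 2"
    "fps_nth K 4 = c^4 * \<delta> 4 0 / 24 + c^2 * \<delta> 2 1 / 2 * (v * p + fps_nth A 1)
       + F 0 2 / 2 * (v * p + fps_nth A 1) ^ 2 + c * \<delta> 1 1 * fps_nth A 2 + F 0 1 * (v * p ^ 2 / 2 + fps_nth A 3)"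
    by (rule K)+
qed

text \<open>
  Here \<open>w\<^sub>i\<close> is the coefficient of \<open>h\<^sup>2\<close> in the displacement of stage \<open>i\<close>, and \<open>x\<^sub>i\<close>, \<open>y\<^sub>i\<close>, \<open>z\<^sub>i\<close> are the
  coefficients of \<open>h\<^sup>2\<close>, \<open>h\<^sup>3\<close>, \<open>h\<^sup>4\<close> in \<open>k\<^sub>i\<close>. The first stage is constant in \<open>h\<close>.
\<close>

lemma increment_fps_nth:
  fixes a :: "nat \<Rightarrow> nat \<Rightarrow> real" and b c \<epsilon>sq :: "nat \<Rightarrow> real" and F :: "nat \<Rightarrow> nat \<Rightarrow> real" and v :: real
  assumes rows: "a 2 1 = c 2" "a 3 1 + a 3 2 = c 3" "a 4 1 + a 4 2 + a 4 3 = c 4"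
  defines "\<delta> \<equiv> frozen_deriv F"
  defines "p \<equiv> \<lambda>i. - \<epsilon>sq i * c i ^ 2"
  defines "w2 \<equiv> v * p 2"
  defines "w3 \<equiv> v * p 3 + a 3 2 * c 2 * \<delta> 1 0"
  defines "w4 \<equiv> v * p 4 + (a 4 2 * c 2 + a 4 3 * c 3) * \<delta> 1 0"
  defines "x2 \<equiv> c 2 ^ 2 * \<delta> 2 0 / 2 + F 0 1 * w2"
  defines "x3 \<equiv> c 3 ^ 2 * \<delta> 2 0 / 2 + F 0 1 * w3"
  defines "x4 \<equiv> c 4 ^ 2 * \<delta> 2 0 / 2 + F 0 1 * w4"
  defines "y2 \<equiv> c 2 ^ 3 * \<delta> 3 0 / 6 + c 2 * \<delta> 1 1 * w2"
  defines "y3 \<equiv> c 3 ^ 3 * \<delta> 3 0 / 6 + c 3 * \<delta> 1 1 * w3 + F 0 1 * (a 3 2 * x2)"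
  defines "y4 \<equiv> c 4 ^ 3 * \<delta> 3 0 / 6 + c 4 * \<delta> 1 1 * w4 + F 0 1 * (a 4 2 * x2 + a 4 3 * x3)"
  defines "z2 \<equiv> c 2 ^ 4 * \<delta> 4 0 / 24 + c 2 ^ 2 * \<delta> 2 1 / 2 * w2 + F 0 2 / 2 * w2 ^ 2
       + F 0 1 * (v * p 2 ^ 2 / 2)"
  defines "z3 \<equiv> c 3 ^ 4 * \<delta> 4 0 / 24 + c 3 ^ 2 * \<delta> 2 1 / 2 * w3 + F 0 2 / 2 * w3 ^ 2
       + c 3 * \<delta> 1 1 * (a 3 2 * x2) + F 0 1 * (v * p 3 ^ 2 / 2 + a 3 2 * y2)"
  defines "z4 \<equiv> c 4 ^ 4 * \<delta> 4 0 / 24 + c 4 ^ 2 * \<delta> 2 1 / 2 * w4 + F 0 2 / 2 * w4 ^ 2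
       + c 4 * \<delta> 1 1 * (a 4 2 * x2 + a 4 3 * x3) + F 0 1 * (v * p 4 ^ 2 / 2 + (a 4 2 * y2 + a 4 3 * y3))"
  defines "I \<equiv> increment_fps F a b c \<epsilon>sq v"
  shows "fps_nth I 0 = (b 1 + b 2 + b 3 + b 4) * F 0 0"
    "fps_nth I 1 = (b 2 * c 2 + b 3 * c 3 + b 4 * c 4) * \<delta> 1 0"
    "fps_nth I 2 = b 2 * x2 + b 3 * x3 + b 4 * x4"
    "fps_nth I 3 = b 2 * y2 + b 3 * y3 + b 4 * y4"
    "fps_nth I 4 = b 2 * z2 + b 3 * z3 + b 4 * z4"
proof -
  define K1 where "K1 = fps_const (F 0 0)"
  define A2 where "A2 = fps_const (a 2 1) * K1"
  define K2 where "K2 = taylor_fps 5 F (c 2) (stage_fps v (p 2) A2)"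
  define A3 where "A3 = fps_const (a 3 1) * K1 + fps_const (a 3 2) * K2"
  define K3 where "K3 = taylor_fps 5 F (c 3) (stage_fps v (p 3) A3)"
  define A4 where "A4 = fps_const (a 4 1) * K1 + fps_const (a 4 2) * K2 + fps_const (a 4 3) * K3"
  define K4 where "K4 = taylor_fps 5 F (c 4) (stage_fps v (p 4) A4)"
  have I: "I = fps_const (b 1) * K1 + fps_const (b 2) * K2 + fps_const (b 3) * K3 + fps_const (b 4) * K4"
    unfolding I_def increment_fps_def Let_def K4_def A4_def K3_def A3_def K2_def A2_def K1_def p_def ..
  have "fps_nth A2 0 = c 2 * F 0 0"
    using rows(1) by (simp add: A2_def K1_def)
  note K2 = stage_coefficients[where F = F, OF this, of v "p 2", folded \<delta>_def K2_def]
  have K2: "fps_nth K2 0 = F 0 0" "fps_nth K2 1 = c 2 * \<delta> 1 0" "fps_nth K2 2 = x2" "fps_nth K2 3 = y2" "fps_nth K2 4 = z2"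
    by (simp_all add: K2 A2_def K1_def x2_def y2_def z2_def w2_def del: One_nat_def)
  have "fps_nth A3 0 = c 3 * F 0 0"
    using rows(2)[symmetric] by (simp add: A3_def K1_def K2 algebra_simps)
  note K3 = stage_coefficients[where F = F, OF this, of v "p 3", folded \<delta>_def K3_def]
  have K3: "fps_nth K3 0 = F 0 0" "fps_nth K3 1 = c 3 * \<delta> 1 0" "fps_nth K3 2 = x3" "fps_nth K3 3 = y3" "fps_nth K3 4 = z3"
    by (simp_all add: K3 A3_def K1_def K2 x3_def y3_def z3_def w3_def mult.assoc del: One_nat_def)
  have "fps_nth A4 0 = c 4 * F 0 0"
    using rows(3)[symmetric] by (simp add: A4_def K1_def K2 K3 algebra_simps)
  note K4 = stage_coefficients[where F = F, OF this, of v "p 4", folded \<delta>_def K4_def]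
  have A4: "fps_nth A4 1 = (a 4 2 * c 2 + a 4 3 * c 3) * \<delta> 1 0"
    by (simp add: A4_def K1_def K2 K3 algebra_simps del: One_nat_def)
  have K4: "fps_nth K4 0 = F 0 0" "fps_nth K4 1 = c 4 * \<delta> 1 0" "fps_nth K4 2 = x4" "fps_nth K4 3 = y4" "fps_nth K4 4 = z4"
    unfolding K4 A4 by (simp_all add: A4_def K1_def K2 K3 x4_def y4_def z4_def w4_def del: One_nat_def)
  show "fps_nth I 0 = (b 1 + b 2 + b 3 + b 4) * F 0 0"
    "fps_nth I 1 = (b 2 * c 2 + b 3 * c 3 + b 4 * c 4) * \<delta> 1 0"
    "fps_nth I 2 = b 2 * x2 + b 3 * x3 + b 4 * x4"
    "fps_nth I 3 = b 2 * y2 + b 3 * y3 + b 4 * y4"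
    "fps_nth I 4 = b 2 * z2 + b 3 * z3 + b 4 * z4"
    by (simp_all add: I K1_def K2 K3 K4 algebra_simps del: One_nat_def)
qed

section \<open>Comparison of the coefficients\<close>

lemma has_order_at_if_coefficients_agree:
  assumes "expands (\<lambda>h. u (t + h) - u t) 6 U" "fps_nth U 0 = 0"
    and "expands (\<lambda>h. rbf_rk4_increment f a b c \<epsilon>sq t (u t) h) 5 I"
    and "p \<le> 5" "\<And>k. k < p \<Longrightarrow> fps_nth U (Suc k) = fps_nth I k"
  shows "has_order_at f a b c \<epsilon>sq u t p"
proof -
  have "expands (\<lambda>h. (u (t + h) - u t) / h) 5 (fps_shift 1 U)"
    using expands_divide_X[of _ 5 U] assms(1,2) by simp
  from expands_mono[OF expands_diff[OF this assms(3)] assms(4)]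
  have "expands (local_truncation_error f a b c \<epsilon>sq u t) p (fps_shift 1 U - I)"
    unfolding local_truncation_error_def .
  then show ?thesis
    using assms(5) by (simp add: expands_def has_order_at_def)
qed

text \<open>
  Sorted by products of derivatives of \<open>f\<close>, each coefficient of the increment is a linear
  combination whose scalar factors are the left-hand sides of the order conditions. Those
  with \<open>\<epsilon>\<^sub>i\<^sup>2\<close> carry the factor \<open>v\<close>, have no counterpart in the exact solution and are required to vanish.
\<close>

lemma order4_coefficients:
  fixes a :: "nat \<Rightarrow> nat \<Rightarrow> real" and b c \<epsilon>sq :: "nat \<Rightarrow> real"
  assumes "order4_conditions a b c \<epsilon>sq" and "fps_nth U 0 = 0"
    and "\<forall>k<5. real (Suc k) * fps_nth U (Suc k) = fps_nth (taylor_fps 5 F 1 U) k"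
    and "k < 4"
  shows "fps_nth U (Suc k) = fps_nth (increment_fps F a b c \<epsilon>sq v) k"
proof -
  have rows: "a 2 1 = c 2" "a 3 1 + a 3 2 = c 3" "a 4 1 + a 4 2 + a 4 3 = c 4"
    and cond:
      "b 1 + b 2 + b 3 + b 4 = 1"
      "b 2 * c 2 + b 3 * c 3 + b 4 * c 4 = 1/2"
      "b 2 * c 2 ^ 2 + b 3 * c 3 ^ 2 + b 4 * c 4 ^ 2 = 1/3"
      "b 2 * c 2 ^ 3 + b 3 * c 3 ^ 3 + b 4 * c 4 ^ 3 = 1/4"
      "a 3 2 * b 3 * c 2 + a 4 2 * b 4 * c 2 + a 4 3 * b 4 * c 3 = 1/6"
      "a 3 2 * b 3 * c 2 * c 3 + a 4 2 * b 4 * c 2 * c 4 + a 4 3 * b 4 * c 3 * c 4 = 1/8"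
      "a 3 2 * b 3 * c 2 ^ 2 + a 4 2 * b 4 * c 2 ^ 2 + a 4 3 * b 4 * c 3 ^ 2 = 1/12"
      "a 3 2 * a 4 3 * b 4 * c 2 = 1/24"
      "b 2 * c 2 ^ 2 * \<epsilon>sq 2 + b 3 * c 3 ^ 2 * \<epsilon>sq 3 + b 4 * c 4 ^ 2 * \<epsilon>sq 4 = 0"
      "b 2 * c 2 ^ 3 * \<epsilon>sq 2 + b 3 * c 3 ^ 3 * \<epsilon>sq 3 + b 4 * c 4 ^ 3 * \<epsilon>sq 4 = 0"
      "a 3 2 * b 3 * c 2 ^ 2 * \<epsilon>sq 2 + a 4 2 * b 4 * c 2 ^ 2 * \<epsilon>sq 2 + a 4 3 * b 4 * c 3 ^ 2 * \<epsilon>sq 3 = 0"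
    using assms(1) unfolding order4_conditions_def by blast+
  note U = exact_coefficients[where F = F, OF assms(2,3)]
  note I = increment_fps_nth[OF rows, where F = F and \<epsilon>sq = \<epsilon>sq and v = v and b = b]
  let ?I = "increment_fps F a b c \<epsilon>sq v" and ?\<delta> = "frozen_deriv F"
  have "fps_nth U 1 = fps_nth ?I 0"
    unfolding I U cond by simp
  moreover have "fps_nth U 2 = fps_nth ?I 1"
    unfolding I U cond by simp
  moreover have "fps_nth U 3 = fps_nth ?I 2"
  proof -
    have "fps_nth ?I 2 = ?\<delta> 2 0 / 2 * (b 2 * c 2 ^ 2 + b 3 * c 3 ^ 2 + b 4 * c 4 ^ 2)
      + F 0 1 * (?\<delta> 1 0 * (a 3 2 * b 3 * c 2 + a 4 2 * b 4 * c 2 + a 4 3 * b 4 * c 3)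
        - v * (b 2 * c 2 ^ 2 * \<epsilon>sq 2 + b 3 * c 3 ^ 2 * \<epsilon>sq 3 + b 4 * c 4 ^ 2 * \<epsilon>sq 4))"
      unfolding I by (simp add: field_simps)
    then show ?thesis
      unfolding U cond by simp
  qed
  moreover have "fps_nth U 4 = fps_nth ?I 3"
  proof -
    have "fps_nth ?I 3 = ?\<delta> 3 0 / 6 * (b 2 * c 2 ^ 3 + b 3 * c 3 ^ 3 + b 4 * c 4 ^ 3)
      + ?\<delta> 1 1 * (?\<delta> 1 0 * (a 3 2 * b 3 * c 2 * c 3 + a 4 2 * b 4 * c 2 * c 4 + a 4 3 * b 4 * c 3 * c 4)
        - v * (b 2 * c 2 ^ 3 * \<epsilon>sq 2 + b 3 * c 3 ^ 3 * \<epsilon>sq 3 + b 4 * c 4 ^ 3 * \<epsilon>sq 4))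
      + F 0 1 * (?\<delta> 2 0 / 2 * (a 3 2 * b 3 * c 2 ^ 2 + a 4 2 * b 4 * c 2 ^ 2 + a 4 3 * b 4 * c 3 ^ 2)
        + F 0 1 * (?\<delta> 1 0 * (a 3 2 * a 4 3 * b 4 * c 2)
          - v * (a 3 2 * b 3 * c 2 ^ 2 * \<epsilon>sq 2 + a 4 2 * b 4 * c 2 ^ 2 * \<epsilon>sq 2 + a 4 3 * b 4 * c 3 ^ 2 * \<epsilon>sq 3)))"
      unfolding I by (simp add: field_simps power2_eq_square power3_eq_cube)
    then show ?thesis
      unfolding U cond by (simp add: field_simps)
  qed
  ultimately show ?thesis
    using \<open>k < 4\<close> by (auto simp: less_Suc_eq eval_nat_numeral)
qed

lemma case1_values:
  assumes "case1_coefficients a b c \<epsilon>sq"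
  shows
    "a 2 1 = 2/5" "c 2 = 2/5" "a 3 1 = - 3/20" "a 3 2 = 3/4" "c 3 = 3/5" "a 4 1 = 19/44"
    "a 4 2 = - 15/44" "a 4 3 = 10/11" "c 4 = 1" "b 1 = 11/72" "b 2 = 25/72" "b 3 = 25/72"
    "b 4 = 11/72" "\<epsilon>sq 3 = - 2/3 * \<epsilon>sq 2"
    "\<epsilon>sq 4 = 2/11 * \<epsilon>sq 2"
  using assms unfolding case1_coefficients_def by blast+

text \<open>
  The factor can be read off from \<open>f\<^sub>t\<^sub>t\<^sub>t\<^sub>t\<close>: its coefficient is \<open>1/120\<close> in the exact solution and
  \<open>(b\<^sub>2 c\<^sub>2\<^sup>4 + b\<^sub>3 c\<^sub>3\<^sup>4 + b\<^sub>4 c\<^sub>4\<^sup>4) / 24\<close> in the increment. The difference is \<open>- 1/3600\<close>, and the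
  polynomial contains \<open>11 f\<^sub>t\<^sub>t\<^sub>t\<^sub>t\<close>.
\<close>

lemma case1_leading_error:
  fixes a :: "nat \<Rightarrow> nat \<Rightarrow> real" and b c \<epsilon>sq :: "nat \<Rightarrow> real"
  assumes coeffs: "case1_coefficients a b c \<epsilon>sq" and "fps_nth U 0 = 0"
    and "\<forall>k<5. real (Suc k) * fps_nth U (Suc k) = fps_nth (taylor_fps 5 F 1 U) k"
  shows "fps_nth U 5 - fps_nth (increment_fps F a b c \<epsilon>sq v) 4 =
    - (case1_alpha F v * (\<epsilon>sq 2)^2 + case1_beta F v * \<epsilon>sq 2 + case1_gamma F (frozen_deriv F 1 0)) / 39600"
proof -
  note vals = case1_values[OF coeffs]
  have rows: "a 2 1 = c 2" "a 3 1 + a 3 2 = c 3" "a 4 1 + a 4 2 + a 4 3 = c 4"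
    unfolding vals by simp_all
  show ?thesis
    unfolding increment_fps_nth[OF rows, where F = F and \<epsilon>sq = \<epsilon>sq and v = v and b = b]
      exact_coefficients[where F = F, OF assms(2,3)]
      case1_alpha_def case1_beta_def case1_gamma_def frozen_deriv_unfold vals
    by (simp add: field_simps power2_eq_square power3_eq_cube power4_eq_xxxx)
qed

lemma case2_values:
  assumes "case2_coefficients a b c \<epsilon>sq"
  shows
    "a 2 1 = 1/4" "c 2 = 1/4" "a 3 1 = - 6/25" "a 3 2 = 21/25" "c 3 = 3/5" "a 4 1 = 6/5"
    "a 4 2 = - 57/35" "a 4 3 = 10/7" "c 4 = 1" "b 1 = 1/9" "b 2 = 16/63" "b 3 = 125/252"
    "b 4 = 5/36" "\<epsilon>sq 3 = - 1/6 * \<epsilon>sq 2"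
    "\<epsilon>sq 4 = 1/10 * \<epsilon>sq 2"
  using assms unfolding case2_coefficients_def by blast+

lemma case2_leading_error:
  fixes a :: "nat \<Rightarrow> nat \<Rightarrow> real" and b c \<epsilon>sq :: "nat \<Rightarrow> real"
  assumes coeffs: "case2_coefficients a b c \<epsilon>sq" and "fps_nth U 0 = 0"
    and "\<forall>k<5. real (Suc k) * fps_nth U (Suc k) = fps_nth (taylor_fps 5 F 1 U) k"
  shows "fps_nth U 5 - fps_nth (increment_fps F a b c \<epsilon>sq v) 4 =
    - (case2_alpha F v * (\<epsilon>sq 2)^2 + case2_beta F v * \<epsilon>sq 2 + case2_gamma F (frozen_deriv F 1 0)) / 5760"
proof -
  note vals = case2_values[OF coeffs]
  have rows: "a 2 1 = c 2" "a 3 1 + a 3 2 = c 3" "a 4 1 + a 4 2 + a 4 3 = c 4"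
    unfolding vals by simp_all
  show ?thesis
    unfolding increment_fps_nth[OF rows, where F = F and \<epsilon>sq = \<epsilon>sq and v = v and b = b]
      exact_coefficients[where F = F, OF assms(2,3)]
      case2_alpha_def case2_beta_def case2_gamma_def frozen_deriv_unfold vals
    by (simp add: field_simps power2_eq_square power3_eq_cube power4_eq_xxxx)
qed

lemma case1_order4:
  assumes "case1_coefficients a b c \<epsilon>sq"
  shows "order4_conditions a b c \<epsilon>sq"
  unfolding order4_conditions_def case1_values[OF assms]
  by (simp add: power2_eq_square power3_eq_cube)

lemma case2_order4:
  assumes "case2_coefficients a b c \<epsilon>sq"
  shows "order4_conditions a b c \<epsilon>sq"
  unfolding order4_conditions_def case2_values[OF assms]
  by (simp add: power2_eq_square power3_eq_cube)

theorem mainTheorem3: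
  fixes f :: "real \<Rightarrow> real \<Rightarrow> real" and u :: "real \<Rightarrow> real" and t :: real
    and D :: "(real \<times> real) set"
    and a :: "nat \<Rightarrow> nat \<Rightarrow> real" and b c \<epsilon>sq :: "nat \<Rightarrow> real"
  assumes D: "open D" "(t, u t) \<in> D"
    and smooth: "Ck_on 5 D f"
    and solution: "\<forall>\<^sub>F s in nhds t. (u has_real_derivative f s (u s)) (at s)"
  shows "(order4_conditions a b c \<epsilon>sq \<longrightarrow> has_order_at f a b c \<epsilon>sq u t 4) \<and>
    (let F = (\<lambda>i j. pd i j f t (u t)); v = u t; w = (deriv ^^ 2) u t in
      (case1_coefficients a b c \<epsilon>sq \<and>
         case1_alpha F v * (\<epsilon>sq 2)^2 + case1_beta F v * \<epsilon>sq 2 + case1_gamma F w = 0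
       \<longrightarrow> has_order_at f a b c \<epsilon>sq u t 5) \<and>
      (case2_coefficients a b c \<epsilon>sq \<and>
         case2_alpha F v * (\<epsilon>sq 2)^2 + case2_beta F v * \<epsilon>sq 2 + case2_gamma F w = 0
       \<longrightarrow> has_order_at f a b c \<epsilon>sq u t 5))"
proof -
  define F where "F = (\<lambda>i j. pd i j f t (u t))"
  obtain U where U: "expands (\<lambda>h. u (t + h) - u t) 6 U" "fps_nth U 0 = 0"
    "\<forall>k<5. real (Suc k) * fps_nth U (Suc k) = fps_nth (taylor_fps 5 F 1 U) k"
    using exact_solution_expands[OF D smooth solution] unfolding F_def by auto
  define I where "I = increment_fps F a b c \<epsilon>sq (u t)"
  have I: "expands (\<lambda>h. rbf_rk4_increment f a b c \<epsilon>sq t (u t) h) 5 I"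
    unfolding I_def F_def by (rule expands_increment[OF D smooth])
  have u'': "(deriv ^^ 2) u t = frozen_deriv F 1 0"
  proof -
    have "(deriv ^^ 2) u t = fps_nth (taylor_fps 5 F 1 U) 1"
      unfolding F_def using second_derivative_exact[OF D smooth solution expands_mono[OF U(1)] U(2)] by simp
    also have "\<dots> = 2 * fps_nth U 2"
      using U(3)[rule_format, of 1] by (simp add: numeral_2_eq_2)
    finally show ?thesis
      unfolding exact_coefficients(2)[OF U(2,3)] by (simp del: One_nat_def)
  qed
  have four: "fps_nth U (Suc k) = fps_nth I k" if "order4_conditions a b c \<epsilon>sq" "k < 4" for k
    unfolding I_def by (rule order4_coefficients[OF that(1) U(2,3) that(2)])
  have order4: "has_order_at f a b c \<epsilon>sq u t 4" if "order4_conditions a b c \<epsilon>sq"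
    using has_order_at_if_coefficients_agree[OF U(1,2) I, of 4] four[OF that] by simp
  have order5: "has_order_at f a b c \<epsilon>sq u t 5"
    if "order4_conditions a b c \<epsilon>sq" "fps_nth U 5 - fps_nth I 4 = 0"
  proof (rule has_order_at_if_coefficients_agree[OF U(1,2) I])
    fix k :: nat assume "k < 5"
    then consider "k < 4" | "k = 4" by linarith
    then show "fps_nth U (Suc k) = fps_nth I k"
      using four[OF that(1)] that(2) by cases (simp_all add: eval_nat_numeral)
  qed simp
  have case1: "has_order_at f a b c \<epsilon>sq u t 5"
    if "case1_coefficients a b c \<epsilon>sq"
      and "case1_alpha F (u t) * (\<epsilon>sq 2)^2 + case1_beta F (u t) * \<epsilon>sq 2
        + case1_gamma F ((deriv ^^ 2) u t) = 0"
    using order5[OF case1_order4[OF that(1)]] case1_leading_error[OF that(1) U(2,3), of "u t"] that(2)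
    unfolding u'' I_def by simp
  have case2: "has_order_at f a b c \<epsilon>sq u t 5"
    if "case2_coefficients a b c \<epsilon>sq"
      and "case2_alpha F (u t) * (\<epsilon>sq 2)^2 + case2_beta F (u t) * \<epsilon>sq 2
        + case2_gamma F ((deriv ^^ 2) u t) = 0"
    using order5[OF case2_order4[OF that(1)]] case2_leading_error[OF that(1) U(2,3), of "u t"] that(2)
    unfolding u'' I_def by simp
  show ?thesis
    using order4 case1 case2 unfolding Let_def F_def[symmetric] by blast
qed

end
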